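(* Let $q\ge1$, $p=p_{\mathrm{sd}}(q)$, and let $\gamma$ be a contour in $\mathbb Z^2$. With $E_i=\mathbf E(\mathrm{int}(\gamma))$, $G$ and $G^w$ as below and $\bar1$ the configuration identically equal to $1$, $$\mathbb P^{G^w,E_i,\bar1}(\gamma\text{ is a }q\text{-contour})\le\big(4q^{-1/8}\big)^{|\gamma|}q^{1/2}.$$
   Context: $p_{\mathrm{sd}}(q)\in(0,1)$ solves $(p/(1-p))^4=q$. Dual lattice: $(\mathbb Z^2)^*=\mathbb Z^2+(\tfrac12,\tfrac12)$. For a directed nearest-neighbour bond $\vec e=(x,y)$ of $\mathbb Z^2$, its dual is the directed bond $\vec e^{\,*}=\big(\tfrac12(x+y+(x-y)^\perp),\tfrac12(x+y+(y-x)^\perp)\big)$ of $(\mathbb Z^2)^*$, where $\perp$ is counter-clockwise rotation by $90^\circ$. A closed path $\gamma=(x_1^*,\dots,x_n^*,x_1^* )$ in $(\mathbb Z^2)^*$ along pairwise distinct directed dual bonds $\vec b_i^{\,*}=(x_i^*,x_{i+1}^* )$ (indices mod $n$) determines primal directed bonds $\vec b_i=(z_i,y_i)$ with duals $\vec b_i^{\,*}$; $\mathbf E(\gamma)$ is the set of undirected primal bonds $b_i$, $\mathbf V(\gamma)^*=\{x_i^*\}$, $|\gamma|=n$. $\gamma$ is a contour if the graph $(\mathbb Z^2,\mathbf E(\mathbb Z^2)\setminus\mathbf E(\gamma))$ has a bounded connected component $\mathrm{int}(\gamma)$ whose set of vertices having a $\mathbb Z^2$-neighbour outside $\mathrm{int}(\gamma)$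 equals $\{z_1,\dots,z_n\}$. For $x^*\in(\mathbb Z^2)^*$ the plaquette with centre $x^*$ is the unit square whose corners are the four points of $\mathbb Z^2$ at distance $\sqrt2/2$ from $x^*$; its faces are its four sides (bonds of $\mathbb Z^2$). $\mathbf E(\mathrm{int}(\gamma))$ is the set of bonds with both endpoints in $\mathrm{int}(\gamma)$. $\gamma$ is a $q$-contour for $\kappa$ if $\kappa_b=1$ for all $b\in\mathbf E(\gamma)$, and for every plaquette with centre in $\mathbf V(\gamma)^*$ every face $b$ of it with $b\in\mathbf E(\mathrm{int}(\gamma))$ has $\kappa_b=q$. $G$ is the graph with edge set $E=E_i\cup\mathbf E(\gamma)$ and the endpoints of these edges as vertices; $G^w$ is obtained from $G$ by identifying all vertices of $G$ not in $\mathrm{int}(\gamma)$ into a single vertex (edges still indexed by $E$). For a finite connected multigraph $H$ and conductances $c$, $\Delta^H_cf(x)=\sum_{e=\{x,y\}}c_e(f(x)-f(y))$ acting on zero-sum functions on $\mathbf V(H)$, determinant $\det\Delta^H_c$. For $E''\subset\mathbf E(H)$ and $\lambda\in\{1,q\}^{\mathbf E(H)}$, $\mathbb P^{H,E'',\lambda}$ is the measure on $\kappa\in\{1,q\}^{E''}$ with $\mathbb P^{H,E'',\lambda}(\kappa)\propto p^{h(\kappa)}(1-p)^{s(\kappa)}(\det\Delta^H_{(\lambda,\kappa)})^{-1/2}$, where $h,s$ count edges of $E''$ with $\kappa_e=q$ resp. $1$, and $(\lambda,\kappa)$ equals $\kappa$ on $E''$ and $\lambda$ elsewhere. The event "$\gamma$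 is a $q$-contour" is evaluated for the configuration $(\bar1,\kappa)$. *)

theory Defs
  imports "HOL-Analysis.Analysis"
begin

definition Z2 :: "complex set" where
  "Z2 = {z. Re z \<in> \<int> \<and> Im z \<in> \<int>}"

definition Z2dual :: "complex set" where
  "Z2dual = (\<lambda>z. z + (1 + \<i>) / 2) ` Z2"

definition perp :: "complex \<Rightarrow> complex" where
  "perp z = \<i> * z"

definition nn :: "complex \<Rightarrow> complex \<Rightarrow> bool" where
  "nn x y \<longleftrightarrow> x \<in> Z2 \<and> y \<in> Z2 \<and> cmod (x - y) = 1"

definition dual_bond :: "complex \<times> complex \<Rightarrow> complex \<times> complex" where
  "dual_bond = (\<lambda>(x, y). ((x + y + perp (x - y)) / 2, (x + y + perp (y - x)) / 2))"

definition closed_dual_path :: "complex list \<Rightarrow> (nat \<Rightarrow> complex) \<Rightarrow> (nat \<Rightarrow> complex) \<Rightarrow> bool" where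
  "closed_dual_path xs z y \<longleftrightarrow>
     (let n = length xs in
        0 < n \<and>
        (\<forall>i<n. nn (z i) (y i) \<and> dual_bond (z i, y i) = (xs ! i, xs ! ((i + 1) mod n))) \<and>
        inj_on (\<lambda>i. (xs ! i, xs ! ((i + 1) mod n))) {..<n})"

definition path_edges :: "complex list \<Rightarrow> (nat \<Rightarrow> complex) \<Rightarrow> (nat \<Rightarrow> complex) \<Rightarrow> complex set set" where
  "path_edges xs z y = {{z i, y i} | i. i < length xs}"

definition adj_minus :: "complex set set \<Rightarrow> complex \<Rightarrow> complex \<Rightarrow> bool" where
  "adj_minus F v w \<longleftrightarrow> nn v w \<and> {v, w} \<notin> F"

definition is_interior :: "complex list \<Rightarrow> (nat \<Rightarrow> complex) \<Rightarrow> (nat \<Rightarrow> complex) \<Rightarrow> complex set \<Rightarrow> bool" where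
  "is_interior xs z y I \<longleftrightarrow>
     bounded I \<and>
     (\<exists>v\<in>Z2. I = {w. (adj_minus (path_edges xs z y))\<^sup>*\<^sup>* v w}) \<and>
     {v \<in> I. \<exists>w. nn v w \<and> w \<notin> I} = z ` {..<length xs}"

definition is_contour :: "complex list \<Rightarrow> (nat \<Rightarrow> complex) \<Rightarrow> (nat \<Rightarrow> complex) \<Rightarrow> bool" where
  "is_contour xs z y \<longleftrightarrow> closed_dual_path xs z y \<and> (\<exists>I. is_interior xs z y I)"

definition edges_within :: "complex set \<Rightarrow> complex set set" where
  "edges_within I = {{a, b} | a b. a \<in> I \<and> b \<in> I \<and> nn a b}"

definition plaquette_corners :: "complex \<Rightarrow> complex set" where
  "plaquette_corners x = {c \<in> Z2. cmod (c - x) = sqrt 2 / 2}"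

definition plaquette_faces :: "complex \<Rightarrow> complex set set" where
  "plaquette_faces x = {{c, d} | c d. c \<in> plaquette_corners x \<and> d \<in> plaquette_corners x \<and> cmod (c - d) = 1}"

definition q_contour :: "real \<Rightarrow> complex list \<Rightarrow> (nat \<Rightarrow> complex) \<Rightarrow> (nat \<Rightarrow> complex) \<Rightarrow> complex set
    \<Rightarrow> (complex set \<Rightarrow> real) \<Rightarrow> bool" where
  "q_contour q xs z y I \<kappa> \<longleftrightarrow>
     (\<forall>b\<in>path_edges xs z y. \<kappa> b = 1) \<and>
     (\<forall>i<length xs. \<forall>b\<in>plaquette_faces (xs ! i). b \<in> edges_within I \<longrightarrow> \<kappa> b = q)"

text \<open>Finite multigraphs: vertex set V, edge index set E, endpoint map ends
(a one- or two-element set; one element = loop).  Laplacian with conductances c.\<close>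
definition laplacian :: "'e set \<Rightarrow> ('e \<Rightarrow> 'v set) \<Rightarrow> ('e \<Rightarrow> real) \<Rightarrow> ('v \<Rightarrow> real) \<Rightarrow> 'v \<Rightarrow> real" where
  "laplacian E ends c f x = (\<Sum>e\<in>{e\<in>E. x \<in> ends e}. c e * (\<Sum>w\<in>ends e. f x - f w))"

definition det_on :: "'a set \<Rightarrow> ('a \<Rightarrow> 'a \<Rightarrow> real) \<Rightarrow> real" where
  "det_on S M = (\<Sum>\<sigma>\<in>{\<sigma>. \<sigma> permutes S}. of_int (sign \<sigma>) * (\<Prod>i\<in>S. M i (\<sigma> i)))"

text \<open>Determinant of the Laplacian acting on zero-sum functions on V: the determinant
of its matrix w.r.t. the basis (delta_w - delta_v0), w in V - {v0}, of that space.
The coefficient of delta_u - delta_v0 in a zero-sum g is g u.\<close>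
definition lap_det :: "'v set \<Rightarrow> 'e set \<Rightarrow> ('e \<Rightarrow> 'v set) \<Rightarrow> ('e \<Rightarrow> real) \<Rightarrow> real" where
  "lap_det V E ends c =
     (let v0 = (SOME v. v \<in> V);
          \<beta> = (\<lambda>w u. (if u = w then 1 else 0) - (if u = v0 then 1 else 0))
      in det_on (V - {v0}) (\<lambda>u w. laplacian E ends c (\<beta> w) u))"

text \<open>Configurations kappa in {1,q}^E'' are encoded by the set A of edges of E'' with
kappa_e = q; the full conductance vector (lambda, kappa) is cfg.\<close>
definition cfg :: "'e set \<Rightarrow> ('e \<Rightarrow> real) \<Rightarrow> real \<Rightarrow> 'e set \<Rightarrow> 'e \<Rightarrow> real" where
  "cfg E'' lam q A e = (if e \<in> E'' then (if e \<in> A then q else 1) else lam e)"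

definition cfg_weight :: "'v set \<Rightarrow> 'e set \<Rightarrow> ('e \<Rightarrow> 'v set) \<Rightarrow> 'e set \<Rightarrow> ('e \<Rightarrow> real)
    \<Rightarrow> real \<Rightarrow> real \<Rightarrow> 'e set \<Rightarrow> real" where
  "cfg_weight V E ends E'' lam p q A =
     p ^ card A * (1 - p) ^ card (E'' - A) * (lap_det V E ends (cfg E'' lam q A)) powr (-1/2)"

definition gibbs_prob :: "'v set \<Rightarrow> 'e set \<Rightarrow> ('e \<Rightarrow> 'v set) \<Rightarrow> 'e set \<Rightarrow> ('e \<Rightarrow> real)
    \<Rightarrow> real \<Rightarrow> real \<Rightarrow> (('e \<Rightarrow> real) \<Rightarrow> bool) \<Rightarrow> real" where
  "gibbs_prob V E ends E'' lam p q P =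
     (\<Sum>A\<in>{A. A \<subseteq> E'' \<and> P (cfg E'' lam q A)}. cfg_weight V E ends E'' lam p q A) /
     (\<Sum>A\<in>Pow E''. cfg_weight V E ends E'' lam p q A)"

text \<open>wiring: all vertices outside I are identified into the single vertex None\<close>
definition wmap :: "complex set \<Rightarrow> complex \<Rightarrow> complex option" where
  "wmap I v = (if v \<in> I then Some v else None)"

definition p_sd :: "real \<Rightarrow> real" where
  "p_sd q = (THE p. 0 < p \<and> p < 1 \<and> (p / (1 - p)) ^ 4 = q)"

end

theory Submission
  imports Defs "Jordan_Normal_Form.Determinant"
begin

text \<open>Write $I=\mathrm{int}(\gamma)$ and let $P$ be the set of plaquettes with all four corners in $I$.
Up to a constant, the determinant on $G^w$ is the determinant $D(\kappa)$ of the Laplacian on $I$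
with Dirichlet conditions. A configuration $\kappa$ for which $\gamma$ is a $q$-contour equals $q$ on
every interior bond with an incomplete adjacent plaquette; it is mapped to the dual configuration
$q/\kappa$, shifted by $(-\frac12,-\frac12)$ and extended by $1$. Then $|\kappa'|_q=|\kappa|_1$, and the map is
injective. With $C$ the curl matrix of $P$, planar duality in the form
$\det(A^TKA)=(\det A_T)^2\,\det K\,\det(CK^{-1}C^T)$, where $A$ is the gradient and $A_T$ an
invertible integer submatrix, bounds $D(\kappa)$ from below by $\prod\kappa\cdot\det(C\kappa^{-1}C^T)$. The
shift identifies $q\,C\kappa^{-1}C^T$ with the block of the Laplacian for $\kappa'$ on lower left corners
of $P$, so Fischer's inequality gives $D(\kappa')\le 4^{|I|-|P|}\,q^{|P|}\det(C\kappa^{-1}C^T)$. Since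
$|I|+|P|=|E_i|+1$, $4|I|=2|E_i|+|\gamma|$ and $|I|-|P|\le|\gamma|$, each weight is at most
$2^{|\gamma|}q^{1/2-|\gamma|/8}$ times the weight of its image.\<close>

section \<open>Determinants over finite index sets\<close>

text \<open>Why self-duality helps: with t = \<open>q powr (1/4)\<close> the odds p/(1-p) equal t.
  For m interior bonds, a of them with conductance q, and f full plaquettes, a weight exceeds that
  of its image by at most t^(a-(m-a)) from the bond factors times 2^(|I|-f) q^((f-a)/2) from the
  determinants. The number a cancels, and the remaining exponent f/2 - m/4 of q is 1/2 -
  |\<gamma>|/8 by the two counting relations.

  The contour condition keeps the determinant factor small: a bond of conductance 1 borders only
  full plaquettes, so in the image no site outside the block of full corners touches a bond of
  conductance q. Fischer's inequality then pays 4 for each such site, never 4q.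

  Duality needs a square gradient matrix, but the gradient on interior bonds alone kills constants.
  So one boundary bond \<open>e0\<close> is kept as a ground, and the others are restored by
  monotonicity in the diagonal. Planarity enters only through statements about functions: potentials
  constant along interior bonds and stream functions constant across the contour.\<close>

lemma det_on_reindex:
  assumes h: "bij_betw h S T" and fin: "finite S"
  shows "det_on T M = det_on S (\<lambda>i j. M (h i) (h j))"
proof -
  have inj: "inj_on h S" and T: "T = h ` S"
    using h by (auto simp: bij_betw_def)
  have bp: "bij_betw (map_permutation S h) {\<sigma>. \<sigma> permutes S} {\<sigma>. \<sigma> permutes T}"
    by (rule bij_betw_byWitness[where f' = "map_permutation T (inv_into S h)"])
      (use h in \<open>auto simp: map_permutation_permutes bij_betw_inv_into bij_betw_inv_into_right
        map_permutation_compose_inv[OF h] map_permutation_compose_inv[OF bij_betw_inv_into[OF h]]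
        bij_betw_imp_inj_on\<close>)
  have "(\<Sum>\<sigma>\<in>{\<sigma>. \<sigma> permutes T}. of_int (sign \<sigma>) * (\<Prod>i\<in>T. M i (\<sigma> i)))
      = (\<Sum>\<sigma>\<in>{\<sigma>. \<sigma> permutes S}. of_int (sign (map_permutation S h \<sigma>)) *
           (\<Prod>i\<in>T. M i (map_permutation S h \<sigma> i)))"
    by (rule sum.reindex_bij_betw[OF bp, symmetric])
  also have "\<dots> = (\<Sum>\<sigma>\<in>{\<sigma>. \<sigma> permutes S}. of_int (sign \<sigma>) * (\<Prod>i\<in>S. M (h i) (h (\<sigma> i))))"
  proof (rule sum.cong[OF refl])
    fix \<sigma> assume "\<sigma> \<in> {\<sigma>. \<sigma> permutes S}"
    then have s: "\<sigma> permutes S" by simp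
    have "sign (map_permutation S h \<sigma>) = sign \<sigma>"
      using sign_map_permutation[OF inj s fin] .
    moreover have "(\<Prod>i\<in>T. M i (map_permutation S h \<sigma> i)) = (\<Prod>i\<in>S. M (h i) (map_permutation S h \<sigma> (h i)))"
      by (rule prod.reindex_bij_betw[OF h, symmetric])
    moreover have "\<dots> = (\<Prod>i\<in>S. M (h i) (h (\<sigma> i)))"
      by (intro prod.cong refl) (simp add: map_permutation_apply[OF inj])
    ultimately show "of_int (sign (map_permutation S h \<sigma>)) * (\<Prod>i\<in>T. M i (map_permutation S h \<sigma> i)) =
         of_int (sign \<sigma>) * (\<Prod>i\<in>S. M (h i) (h (\<sigma> i)))" by simp
  qed
  finally show ?thesis by (simp add: det_on_def)
qed

lemma det_on_cong:
  assumes "\<And>i j. i \<in> S \<Longrightarrow> j \<in> S \<Longrightarrow> M i j = N i j"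
  shows "det_on S M = det_on S N"
  unfolding det_on_def
  by (intro sum.cong refl arg_cong2[where f="(*)"] prod.cong) (auto simp: assms permutes_in_image)

text \<open>Bridge to matrices: once the index set is enumerated, multiplicativity, transposition,
  kernels, solvability and block forms carry over from there.\<close>

lemma det_on_mat:
  "det_on {..<n} M = Determinant.det (mat n n (\<lambda>(i, j). M i j))"
proof -
  have "(\<Prod>i = 0..<n. mat n n (\<lambda>(i, j). M i j) $$ (i, p i)) = (\<Prod>i\<in>{..<n}. M i (p i))"
    if "p permutes {..<n}" for p
    using permutes_in_image[OF that]
    by (auto simp: atLeast0LessThan intro!: prod.cong)
  then show ?thesis
    by (simp add: det_def'[where n = n] det_on_def atLeast0LessThan)
qed

lemma ex_enumeration:
  assumes "finite S"
  obtains h :: "nat \<Rightarrow> 'a" where "bij_betw h {..<card S} S"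
  using ex_bij_betw_nat_finite[OF assms] by (auto simp: atLeast0LessThan)

lemma det_on_mult:
  assumes fin: "finite S"
  shows "det_on S (\<lambda>i k. \<Sum>j\<in>S. M i j * N j k) = det_on S M * det_on S N"
proof -
  obtain h where h: "bij_betw h {..<card S} S" using ex_enumeration[OF fin] .
  let ?n = "card S"
  let ?M = "mat ?n ?n (\<lambda>(i, j). M (h i) (h j))" and ?N = "mat ?n ?n (\<lambda>(i, j). N (h i) (h j))"
  have "mat ?n ?n (\<lambda>(i, k). \<Sum>j\<in>S. M (h i) j * N j (h k)) = ?M * ?N"
    by (rule eq_matI)
      (auto simp: scalar_prod_def sum.reindex_bij_betw[OF h, symmetric] atLeast0LessThan)
  then show ?thesis
    by (simp add: det_on_reindex[OF h] det_on_mat det_mult[where n = ?n])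
qed

lemma det_on_transpose:
  assumes fin: "finite S"
  shows "det_on S (\<lambda>i j. M j i) = det_on S M"
proof -
  obtain h where h: "bij_betw h {..<card S} S" using ex_enumeration[OF fin] .
  let ?n = "card S"
  have "mat ?n ?n (\<lambda>(i, j). M (h j) (h i)) = transpose_mat (mat ?n ?n (\<lambda>(i, j). M (h i) (h j)))"
    by (rule eq_matI) auto
  then show ?thesis
    by (simp add: det_on_reindex[OF h] det_on_mat Determinant.det_transpose[where n = ?n])
qed

lemma det_on_eq_0_kernel:
  fixes M :: "'a \<Rightarrow> 'a \<Rightarrow> real"
  assumes fin: "finite S" and det: "det_on S M = 0"
  obtains x where "\<exists>i\<in>S. x i \<noteq> 0" "\<And>i. i \<in> S \<Longrightarrow> (\<Sum>j\<in>S. M i j * x j) = 0"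
proof -
  obtain h where h: "bij_betw h {..<card S} S" using ex_enumeration[OF fin] .
  let ?n = "card S"
  let ?M = "mat ?n ?n (\<lambda>(i, j). M (h i) (h j))"
  have "Determinant.det ?M = 0"
    using det by (simp add: det_on_reindex[OF h] det_on_mat)
  then obtain v where v: "v \<in> carrier_vec ?n" "v \<noteq> 0\<^sub>v ?n" "?M *\<^sub>v v = 0\<^sub>v ?n"
    using det_0_iff_vec_prod_zero[of ?M ?n] by auto
  define g where "g = inv_into {..<?n} h"
  have g: "g (h k) = k" if "k < ?n" for k
    using h that by (simp add: g_def bij_betw_def)
  have S: "\<exists>k<?n. i = h k" if "i \<in> S" for i
    using h that by (auto simp: bij_betw_def)
  show thesis
  proof (rule that[of "\<lambda>i. vec_index v (g i)"])
    obtain k where k: "k < ?n" "vec_index v k \<noteq> 0"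
      using v(1,2) by (metis carrier_vecD eq_vecI index_zero_vec(1) index_zero_vec(2))
    then show "\<exists>i\<in>S. vec_index v (g i) \<noteq> 0"
      using h by (intro bexI[of _ "h k"]) (auto simp: g bij_betw_def)
  next
    fix i assume "i \<in> S"
    then obtain k where k: "k < ?n" "i = h k" using S by auto
    have "(\<Sum>j\<in>S. M i j * vec_index v (g j)) = (\<Sum>l<?n. M i (h l) * vec_index v (g (h l)))"
      by (rule sum.reindex_bij_betw[OF h, symmetric])
    also have "\<dots> = (\<Sum>l<?n. M (h k) (h l) * vec_index v l)"
      by (intro sum.cong) (auto simp: g k)
    also have "\<dots> = vec_index (?M *\<^sub>v v) k"
      using k v(1) by (auto simp: scalar_prod_def atLeast0LessThan)
    also have "\<dots> = 0" using v(3) k by simp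
    finally show "(\<Sum>j\<in>S. M i j * vec_index v (g j)) = 0" .
  qed
qed

lemma det_on_nonzero_solve:
  fixes M :: "'a \<Rightarrow> 'a \<Rightarrow> real"
  assumes fin: "finite S" and det: "det_on S M \<noteq> 0"
  shows "\<exists>x. \<forall>i\<in>S. (\<Sum>j\<in>S. M i j * x j) = b i"
proof -
  obtain h where h: "bij_betw h {..<card S} S" using ex_enumeration[OF fin] .
  let ?n = "card S"
  let ?M = "mat ?n ?n (\<lambda>(i, j). M (h i) (h j))"
  have "Determinant.det ?M \<noteq> 0"
    using det by (simp add: det_on_reindex[OF h] det_on_mat)
  then have "?M \<in> Units (ring_mat TYPE(real) ?n ())"
    by (intro det_non_zero_imp_unit) auto
  then obtain N where N: "N \<in> carrier_mat ?n ?n" "?M * N = 1\<^sub>m ?n"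
    by (auto simp: Units_def ring_mat_def)
  define w where "w = vec ?n (\<lambda>k. b (h k))"
  define v where "v = N *\<^sub>v w"
  have v: "v \<in> carrier_vec ?n" and Mv: "?M *\<^sub>v v = w"
  proof -
    show "v \<in> carrier_vec ?n" using N by (simp add: v_def w_def)
    have "?M *\<^sub>v v = (?M * N) *\<^sub>v w"
      unfolding v_def using N by (intro assoc_mult_mat_vec[symmetric]) (auto simp: w_def)
    then show "?M *\<^sub>v v = w" using N by (simp add: w_def)
  qed
  define g where "g = inv_into {..<?n} h"
  have g: "g (h k) = k" if "k < ?n" for k
    using h that by (simp add: g_def bij_betw_def)
  show ?thesis
  proof (intro exI[of _ "\<lambda>i. vec_index v (g i)"] ballI)
    fix i assume "i \<in> S"
    then obtain k where k: "k < ?n" "i = h k" using h by (auto simp: bij_betw_def)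
    have "(\<Sum>j\<in>S. M i j * vec_index v (g j)) = (\<Sum>l<?n. M i (h l) * vec_index v (g (h l)))"
      by (rule sum.reindex_bij_betw[OF h, symmetric])
    also have "\<dots> = (\<Sum>l<?n. M (h k) (h l) * vec_index v l)"
      by (intro sum.cong) (auto simp: g k)
    also have "\<dots> = vec_index (?M *\<^sub>v v) k"
      using k v by (auto simp: scalar_prod_def atLeast0LessThan)
    also have "\<dots> = b i" using Mv k by (simp add: w_def)
    finally show "(\<Sum>j\<in>S. M i j * vec_index v (g j)) = b i" .
  qed
qed

lemma det_on_block_triangular:
  fixes M :: "'a \<Rightarrow> 'a \<Rightarrow> real"
  assumes fin: "finite S" "finite T" and disj: "S \<inter> T = {}"
    and zero: "\<And>i j. i \<in> T \<Longrightarrow> j \<in> S \<Longrightarrow> M i j = 0"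
  shows "det_on (S \<union> T) M = det_on S M * det_on T M"
proof -
  obtain f where f: "bij_betw f {..<card S} S" using ex_enumeration[OF fin(1)] .
  obtain g where g: "bij_betw g {..<card T} T" using ex_enumeration[OF fin(2)] .
  let ?m = "card S" and ?n = "card T"
  define h where "h k = (if k < ?m then f k else g (k - ?m))" for k
  have h: "bij_betw h {..<?m + ?n} (S \<union> T)"
  proof -
    have "bij_betw h {..<?m} S"
      using f by (rule bij_betw_cong[THEN iffD1, rotated]) (auto simp: h_def)
    moreover have "bij_betw h {?m..<?m + ?n} T"
    proof -
      have "bij_betw (\<lambda>k. k - ?m) {?m..<?m + ?n} {..<?n}"
        by (rule bij_betwI[where g = "\<lambda>k. k + ?m"]) auto
      from bij_betw_trans[OF this g] show ?thesis
        by (rule bij_betw_cong[THEN iffD1, rotated]) (auto simp: h_def)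
    qed
    ultimately have "bij_betw h ({..<?m} \<union> {?m..<?m + ?n}) (S \<union> T)"
      using disj by (rule bij_betw_combine)
    moreover have "{..<?m} \<union> {?m..<?m + ?n} = {..<?m + ?n}" by auto
    ultimately show ?thesis by simp
  qed
  let ?A = "mat ?m ?m (\<lambda>(i, j). M (f i) (f j))" and ?D = "mat ?n ?n (\<lambda>(i, j). M (g i) (g j))"
  let ?B = "mat ?m ?n (\<lambda>(i, j). M (f i) (g j))"
  have fS: "f i \<in> S" if "i < ?m" for i using f that by (auto simp: bij_betw_def)
  have gT: "g i \<in> T" if "i < ?n" for i using g that by (auto simp: bij_betw_def)
  have "mat (?m + ?n) (?m + ?n) (\<lambda>(i, j). M (h i) (h j)) = four_block_mat ?A ?B (0\<^sub>m ?n ?m) ?D"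
    by (rule eq_matI) (auto simp: h_def zero fS gT)
  moreover have "Determinant.det (four_block_mat ?A ?B (0\<^sub>m ?n ?m) ?D)
      = Determinant.det ?A * Determinant.det ?D"
    by (rule det_four_block_mat_lower_left_zero) auto
  moreover have "finite {..<?m + ?n}" by simp
  ultimately show ?thesis
    by (simp only: det_on_reindex[OF h] det_on_reindex[OF f] det_on_reindex[OF g] finite_lessThan det_on_mat)
qed

lemma det_on_singleton [simp]: "det_on {v} M = M v v"
  by (simp add: det_on_def)

lemma det_on_empty [simp]: "det_on {} M = 1"
  by (simp add: det_on_def)

text \<open>A permutation with nonzero product never lowers \<open>ht\<close>; since it preserves
  the sum of \<open>ht\<close> over \<open>S\<close>, it preserves every height, and strictness off
  the diagonal makes it the identity. The height function replaces a linear order on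
  \<open>S\<close>.\<close>

lemma det_on_unit_triangular:
  fixes M :: "'a \<Rightarrow> 'a \<Rightarrow> real" and ht :: "'a \<Rightarrow> int"
  assumes fin: "finite S" and diag: "\<And>i. i \<in> S \<Longrightarrow> M i i = 1"
    and ht: "\<And>i j. i \<in> S \<Longrightarrow> j \<in> S \<Longrightarrow> i \<noteq> j \<Longrightarrow> M i j \<noteq> 0 \<Longrightarrow> ht i < ht j"
  shows "det_on S M = 1"
proof -
  have zero: "(\<Prod>i\<in>S. M i (\<sigma> i)) = 0" if \<sigma>: "\<sigma> permutes S" "\<sigma> \<noteq> id" for \<sigma>
  proof (rule ccontr)
    assume "(\<Prod>i\<in>S. M i (\<sigma> i)) \<noteq> 0"
    then have nz: "M i (\<sigma> i) \<noteq> 0" if "i \<in> S" for i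
      using fin that by (simp add: prod_zero_iff)
    have le: "ht i \<le> ht (\<sigma> i)" if "i \<in> S" for i
      using ht[OF that _ _ nz[OF that]] permutes_in_image[OF \<sigma>(1), of i] that by fastforce
    have "(\<Sum>i\<in>S. ht (\<sigma> i)) = (\<Sum>i\<in>S. ht i)"
      using sum.permute[OF \<sigma>(1), of ht] by (simp add: comp_def)
    then have eq: "ht i = ht (\<sigma> i)" if "i \<in> S" for i
      using sum_mono_inv[of ht S "\<lambda>i. ht (\<sigma> i)" i] le that fin by simp
    have "\<sigma> i = i" for i
    proof (cases "i \<in> S")
      case True
      then show ?thesis
        using ht[OF True _ _ nz[OF True]] permutes_in_image[OF \<sigma>(1), of i] eq[OF True] by fastforce
    qed (use \<sigma>(1) in \<open>simp add: permutes_def\<close>)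
    then show False using \<sigma>(2) by auto
  qed
  have "det_on S M = (\<Sum>\<sigma>\<in>{\<sigma>. \<sigma> permutes S}. if \<sigma> = id then 1 else 0)"
    unfolding det_on_def by (intro sum.cong refl) (auto simp: zero diag sign_id)
  also have "\<dots> = 1"
    using finite_permutations[OF fin] by (simp add: permutes_id)
  finally show ?thesis .
qed

text \<open>Column \<open>v\<close> minus the combination of the other columns with coefficients
  \<open>y\<close> vanishes on \<open>S\<close>. This column operation is multiplication by the unit
  triangular \<open>U\<close>, so it leaves the determinant unchanged.\<close>

lemma det_on_schur:
  fixes M :: "'a \<Rightarrow> 'a \<Rightarrow> real"
  assumes fin: "finite S" and v: "v \<notin> S"
    and y: "\<And>i. i \<in> S \<Longrightarrow> (\<Sum>j\<in>S. M i j * y j) = M i v"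
  shows "det_on (insert v S) M = det_on S M * (M v v - (\<Sum>j\<in>S. M v j * y j))"
proof -
  let ?T = "insert v S"
  define U where "U i j = (if i = j then 1 else if j = v then - y i else 0)" for i j
  have U: "det_on ?T U = 1"
    by (rule det_on_unit_triangular[where ht = "\<lambda>i. if i = v then 1 else 0"])
      (use fin in \<open>auto simp: U_def split: if_splits\<close>)
  define N where "N i k = (\<Sum>j\<in>?T. M i j * U j k)" for i k
  have NS: "N i k = M i k" if "k \<in> S" for i k
  proof -
    have "N i k = (\<Sum>j\<in>?T. if j = k then M i k else 0)"
      unfolding N_def by (intro sum.cong refl) (use that v in \<open>auto simp: U_def\<close>)
    then show ?thesis using fin that by simp
  qed
  have Nv: "N i v = M i v - (\<Sum>j\<in>S. M i j * y j)" for i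
  proof -
    have "(\<Sum>j\<in>S. M i j * U j v) = (\<Sum>j\<in>S. - (M i j * y j))"
      by (intro sum.cong refl) (use v in \<open>auto simp: U_def\<close>)
    then show ?thesis using fin v by (simp add: N_def sum_negf U_def)
  qed
  have "det_on ?T M = det_on ?T N"
    using det_on_mult[of ?T M U] fin U by (simp add: N_def[abs_def] del: sum.insert)
  \<comment> \<open>Transposition moves the vanishing column entries into the block that
    \<open>det_on_block_triangular\<close> requires to be zero.\<close>
  also have "\<dots> = det_on ?T (\<lambda>i j. N j i)"
    by (rule det_on_transpose[symmetric]) (use fin in simp)
  also have "\<dots> = det_on (S \<union> {v}) (\<lambda>i j. N j i)" by simp
  also have "\<dots> = det_on S (\<lambda>i j. N j i) * N v v"
    by (subst det_on_block_triangular) (use fin v in \<open>auto simp: Nv y\<close>)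
  also have "det_on S (\<lambda>i j. N j i) = det_on S N"
    using fin by (rule det_on_transpose)
  also have "\<dots> = det_on S M"
    by (rule det_on_cong) (rule NS)
  finally show ?thesis by (simp add: Nv)
qed

section \<open>Positive definite matrices\<close>

definition pos_def_on :: "'a set \<Rightarrow> ('a \<Rightarrow> 'a \<Rightarrow> real) \<Rightarrow> bool" where
  "pos_def_on S M \<longleftrightarrow> (\<forall>x. (\<exists>i\<in>S. x i \<noteq> 0) \<longrightarrow> 0 < (\<Sum>i\<in>S. \<Sum>j\<in>S. x i * M i j * x j))"

lemma pos_def_on_subset:
  assumes pd: "pos_def_on T M" and sub: "S \<subseteq> T" and fin: "finite T"
  shows "pos_def_on S M"
  unfolding pos_def_on_def
proof (intro allI impI)
  fix x :: "'a \<Rightarrow> real" assume x: "\<exists>i\<in>S. x i \<noteq> 0"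
  define x' where "x' i = (if i \<in> S then x i else 0)" for i
  have "0 < (\<Sum>i\<in>T. \<Sum>j\<in>T. x' i * M i j * x' j)"
  proof (rule pd[unfolded pos_def_on_def, rule_format])
    show "\<exists>i\<in>T. x' i \<noteq> 0" using x sub by (auto simp: x'_def)
  qed
  also have "\<dots> = (\<Sum>i\<in>S. \<Sum>j\<in>T. x' i * M i j * x' j)"
    by (rule sum.mono_neutral_right) (use fin sub in \<open>auto simp: x'_def\<close>)
  also have "\<dots> = (\<Sum>i\<in>S. \<Sum>j\<in>S. x' i * M i j * x' j)"
    by (intro sum.cong refl sum.mono_neutral_right) (use fin sub in \<open>auto simp: x'_def\<close>)
  also have "\<dots> = (\<Sum>i\<in>S. \<Sum>j\<in>S. x i * M i j * x j)"
    by (intro sum.cong refl) (auto simp: x'_def)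
  finally show "0 < (\<Sum>i\<in>S. \<Sum>j\<in>S. x i * M i j * x j)" .
qed

lemma pos_def_on_det_nonzero:
  assumes pd: "pos_def_on S M" and fin: "finite S"
  shows "det_on S M \<noteq> 0"
proof
  assume "det_on S M = 0"
  then obtain x where x: "\<exists>i\<in>S. x i \<noteq> 0" "\<And>i. i \<in> S \<Longrightarrow> (\<Sum>j\<in>S. M i j * x j) = 0"
    using det_on_eq_0_kernel[OF fin] by blast
  have "(\<Sum>i\<in>S. \<Sum>j\<in>S. x i * M i j * x j) = (\<Sum>i\<in>S. x i * (\<Sum>j\<in>S. M i j * x j))"
    by (simp add: sum_distrib_left mult.assoc)
  also have "\<dots> = 0" by (simp add: x(2))
  finally show False using pd x(1) by (auto simp: pos_def_on_def)
qed

text \<open>Here \<open>s\<close> is the quadratic form of the inverse of the \<open>S\<close>-block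
  at column \<open>v\<close>. Evaluating the form of \<open>M\<close> at \<open>y\<close> gives
  \<open>0 \<le> s\<close>, and evaluating it at the vector equal to 1 at \<open>v\<close> and
  \<open>- y\<close> on \<open>S\<close> gives \<open>s < M v v\<close>. Since \<open>s\<close> does
  not depend on \<open>a\<close>, the determinant is affine in the diagonal entry at
  \<open>v\<close>; Fischer's inequality and monotonicity in the diagonal both rest on this.\<close>

lemma pos_def_on_schur:
  assumes pd: "pos_def_on (insert v S) M" and fin: "finite S" and v: "v \<notin> S"
    and sym: "\<And>i. i \<in> S \<Longrightarrow> M v i = M i v"
  obtains s where "0 \<le> s" "s < M v v"
    "\<And>a. det_on (insert v S) (\<lambda>i j. M i j + (if i = v \<and> j = v then a else 0)) = det_on S M * (M v v + a - s)"
proof -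
  have pdS: "pos_def_on S M"
    by (rule pos_def_on_subset[OF pd]) (use fin in auto)
  obtain y where y: "\<And>i. i \<in> S \<Longrightarrow> (\<Sum>j\<in>S. M i j * y j) = M i v"
    using det_on_nonzero_solve[OF fin pos_def_on_det_nonzero[OF pdS fin], of "\<lambda>i. M i v"] by auto
  define s where "s = (\<Sum>j\<in>S. M v j * y j)"
  have quad: "(\<Sum>i\<in>S. \<Sum>j\<in>S. y i * M i j * y j) = s"
  proof -
    have "(\<Sum>i\<in>S. \<Sum>j\<in>S. y i * M i j * y j) = (\<Sum>i\<in>S. y i * (\<Sum>j\<in>S. M i j * y j))"
      by (simp add: sum_distrib_left mult.assoc)
    also have "\<dots> = s" by (auto simp: s_def y sym intro!: sum.cong)
    finally show ?thesis .
  qed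
  have "0 \<le> s"
  proof (cases "\<exists>i\<in>S. y i \<noteq> 0")
    case True
    then show ?thesis using pdS quad by (auto simp: pos_def_on_def less_imp_le)
  next
    case False
    then show ?thesis by (simp add: s_def)
  qed
  moreover have "s < M v v"
  proof -
    define x where "x i = (if i = v then 1 else - y i)" for i
    have xS: "x i = - y i" if "i \<in> S" for i using that v by (auto simp: x_def)
    have "0 < (\<Sum>i\<in>insert v S. \<Sum>j\<in>insert v S. x i * M i j * x j)"
      by (rule pd[unfolded pos_def_on_def, rule_format]) (simp add: x_def)
    also have "\<dots> = M v v - s - (\<Sum>i\<in>S. y i * M i v) + s"
    proof -
      have 1: "(\<Sum>j\<in>S. x v * M v j * x j) = - s"
        by (simp add: s_def sum_negf[symmetric] xS x_def[of v])
      have 2: "(\<Sum>i\<in>S. x i * M i v * x v) = - (\<Sum>i\<in>S. y i * M i v)"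
        by (simp add: sum_negf[symmetric] xS x_def[of v])
      have 3: "(\<Sum>i\<in>S. \<Sum>j\<in>S. x i * M i j * x j) = s"
        unfolding quad[symmetric] by (intro sum.cong refl) (simp add: xS)
      show ?thesis
        using fin v by (simp add: sum.distrib 1 2 3) (simp add: x_def)
    qed
    also have "(\<Sum>i\<in>S. y i * M i v) = s"
      by (auto simp: s_def sym mult.commute intro!: sum.cong)
    finally show ?thesis by simp
  qed
  moreover have "det_on (insert v S) (\<lambda>i j. M i j + (if i = v \<and> j = v then a else 0)) = det_on S M * (M v v + a - s)" for a
  proof -
    let ?N = "\<lambda>i j. M i j + (if i = v \<and> j = v then a else 0)"
    have "det_on (insert v S) ?N = det_on S ?N * (?N v v - (\<Sum>j\<in>S. ?N v j * y j))"
    proof (rule det_on_schur[OF fin v])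
      fix i assume i: "i \<in> S"
      have "(\<Sum>j\<in>S. ?N i j * y j) = (\<Sum>j\<in>S. M i j * y j)"
        by (intro sum.cong refl) (use i v in auto)
      then show "(\<Sum>j\<in>S. ?N i j * y j) = ?N i v"
        using y[OF i] i v by auto
    qed
    also have "(\<Sum>j\<in>S. ?N v j * y j) = s"
      unfolding s_def by (intro sum.cong refl) (use v in auto)
    also have "det_on S ?N = det_on S M"
      by (rule det_on_cong) (use v in auto)
    finally show ?thesis by simp
  qed
  ultimately show thesis by (rule that)
qed

lemma pos_def_on_det_pos:
  assumes "finite S" and "pos_def_on S M" and "\<And>i j. i \<in> S \<Longrightarrow> j \<in> S \<Longrightarrow> M i j = M j i"
  shows "0 < det_on S M"
  using assms
proof (induction S rule: finite_induct)
  case (insert v S)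
  obtain s where s: "s < M v v"
    "\<And>a. det_on (insert v S) (\<lambda>i j. M i j + (if i = v \<and> j = v then a else 0)) = det_on S M * (M v v + a - s)"
    by (rule pos_def_on_schur[OF insert.prems(1) insert.hyps]) (use insert.prems(2) in auto)
  have "0 < det_on S M"
    using pos_def_on_subset[OF insert.prems(1), of S] insert by auto
  then show ?case using s(1) s(2)[of 0] by simp
qed simp

text \<open>Each \<open>v\<close> of \<open>T\<close> contributes a factor \<open>M v v - s\<close>,
  at most \<open>M v v\<close>, so the block on \<open>T\<close> is bounded by its diagonal as in
  Hadamard's inequality.\<close>

lemma det_on_fischer:
  assumes "finite T" "finite S" "S \<inter> T = {}" and "pos_def_on (S \<union> T) M"
    and "\<And>i j. i \<in> S \<union> T \<Longrightarrow> j \<in> S \<union> T \<Longrightarrow> M i j = M j i"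
  shows "det_on (S \<union> T) M \<le> (\<Prod>v\<in>T. M v v) * det_on S M"
  using assms
proof (induction T rule: finite_induct)
  case (insert v T)
  have pd: "pos_def_on (insert v (S \<union> T)) M" using insert.prems(3) by simp
  have v: "v \<notin> S \<union> T" and fin: "finite (S \<union> T)" using insert by auto
  obtain s where s: "0 \<le> s" "s < M v v"
    "\<And>a. det_on (insert v (S \<union> T)) (\<lambda>i j. M i j + (if i = v \<and> j = v then a else 0)) = det_on (S \<union> T) M * (M v v + a - s)"
    by (rule pos_def_on_schur[OF pd fin v]) (use insert.prems(4) in auto)
  have pd': "pos_def_on (S \<union> T) M"
    by (rule pos_def_on_subset[OF pd]) (use fin in auto)
  have "0 < det_on (S \<union> T) M"
    by (rule pos_def_on_det_pos[OF fin pd']) (use insert.prems(4) in auto)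
  moreover have "det_on (S \<union> T) M \<le> (\<Prod>v\<in>T. M v v) * det_on S M"
    by (rule insert.IH) (use insert.prems pd' in auto)
  ultimately have "det_on (insert v (S \<union> T)) M \<le> M v v * ((\<Prod>v\<in>T. M v v) * det_on S M)"
  proof -
    have "det_on (insert v (S \<union> T)) M = det_on (S \<union> T) M * (M v v - s)"
      using s(3)[of 0] by simp
    also have "\<dots> \<le> det_on (S \<union> T) M * M v v"
      using s(1) \<open>0 < det_on (S \<union> T) M\<close> by simp
    also have "\<dots> \<le> ((\<Prod>v\<in>T. M v v) * det_on S M) * M v v"
      using \<open>det_on (S \<union> T) M \<le> _\<close> s(1,2) by (intro mult_right_mono) auto
    finally show ?thesis by (simp add: mult.commute)
  qed
  then show ?case using insert.hyps by (simp add: mult.assoc)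
qed simp

lemma pos_def_on_add_diag:
  assumes pd: "pos_def_on S M" and d: "\<And>i. i \<in> S \<Longrightarrow> 0 \<le> d i" and fin: "finite S"
  shows "pos_def_on S (\<lambda>i j. M i j + (if i = j then d i else 0))"
  unfolding pos_def_on_def
proof (intro allI impI)
  fix x :: "'a \<Rightarrow> real" assume x: "\<exists>i\<in>S. x i \<noteq> 0"
  have "(\<Sum>i\<in>S. \<Sum>j\<in>S. x i * (M i j + (if i = j then d i else 0)) * x j)
      = (\<Sum>i\<in>S. \<Sum>j\<in>S. x i * M i j * x j) + (\<Sum>i\<in>S. \<Sum>j\<in>S. if i = j then d i * (x i)\<^sup>2 else 0)"
    unfolding sum.distrib[symmetric]
    by (intro sum.cong refl) (auto simp: algebra_simps power2_eq_square)
  moreover have "0 \<le> (\<Sum>i\<in>S. \<Sum>j\<in>S. if i = j then d i * (x i)\<^sup>2 else 0)"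
    using d by (intro sum_nonneg) auto
  ultimately show "0 < (\<Sum>i\<in>S. \<Sum>j\<in>S. x i * (M i j + (if i = j then d i else 0)) * x j)"
    using pd x by (force simp: pos_def_on_def)
qed

text \<open>Raising one diagonal entry changes the determinant by the increment times a principal
  minor, which is positive.\<close>

lemma det_on_add_diag_mono:
  assumes fin: "finite S" and pd: "pos_def_on S M"
    and sym: "\<And>i j. i \<in> S \<Longrightarrow> j \<in> S \<Longrightarrow> M i j = M j i"
    and d: "\<And>i. i \<in> S \<Longrightarrow> 0 \<le> d i"
  shows "det_on S M \<le> det_on S (\<lambda>i j. M i j + (if i = j then d i else 0))"
proof -
  \<comment> \<open>The induction raises the entries in \<open>T\<close> one at a time, so that each
    intermediate matrix is again positive definite.\<close>
  have "det_on S M \<le> det_on S (\<lambda>i j. M i j + (if i = j \<and> i \<in> T then d i else 0))"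
    if "finite T" "T \<subseteq> S" for T
    using that
  proof (induction T rule: finite_induct)
    case (insert v T)
    let ?N = "\<lambda>i j. M i j + (if i = j \<and> i \<in> T then d i else 0)"
    have "pos_def_on S (\<lambda>i j. M i j + (if i = j then if i \<in> T then d i else 0 else 0))"
      by (rule pos_def_on_add_diag[OF pd]) (use d fin in auto)
    moreover have "(\<lambda>i j. M i j + (if i = j then if i \<in> T then d i else 0 else 0)) = ?N"
      by (auto simp: fun_eq_iff)
    ultimately have pdN: "pos_def_on S ?N" by simp
    have S: "insert v (S - {v}) = S" using insert.prems by auto
    have pdN': "pos_def_on (insert v (S - {v})) ?N" using pdN S by simp
    obtain s where s: "0 \<le> s" "s < ?N v v"
      "\<And>a. det_on (insert v (S - {v})) (\<lambda>i j. ?N i j + (if i = v \<and> j = v then a else 0))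
         = det_on (S - {v}) ?N * (?N v v + a - s)"
      by (rule pos_def_on_schur[OF pdN']) (use fin sym insert.prems in auto)
    note s3 = s(3)[unfolded S]
    have pos: "0 < det_on (S - {v}) ?N"
    proof (rule pos_def_on_det_pos)
      show "pos_def_on (S - {v}) ?N"
        by (rule pos_def_on_subset[OF pdN]) (use fin in auto)
    qed (use fin sym in auto)
    have "det_on S M \<le> det_on S ?N" using insert by auto
    also have "\<dots> = det_on (S - {v}) ?N * (?N v v - s)"
      using s3[of 0] by simp
    also have "\<dots> \<le> det_on (S - {v}) ?N * (?N v v + d v - s)"
      using pos d[of v] insert.prems by (intro mult_left_mono) auto
    also have "\<dots> = det_on S (\<lambda>i j. ?N i j + (if i = v \<and> j = v then d v else 0))"
      using s3[of "d v"] by simp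
    also have "\<dots> = det_on S (\<lambda>i j. M i j + (if i = j \<and> i \<in> insert v T then d i else 0))"
      by (rule det_on_cong) (use insert.hyps in auto)
    finally show ?case .
  qed simp
  note this[OF fin order_refl]
  also have "det_on S (\<lambda>i j. M i j + (if i = j \<and> i \<in> S then d i else 0))
      = det_on S (\<lambda>i j. M i j + (if i = j then d i else 0))"
    by (rule det_on_cong) auto
  finally show ?thesis .
qed

text \<open>The quadratic form is a sum of squares of the coordinates of \<open>A\<close> applied to
  \<open>x\<close>, weighted by \<open>K\<close>.\<close>

lemma pos_def_on_gram:
  fixes A :: "'e \<Rightarrow> 'a \<Rightarrow> real" and K :: "'e \<Rightarrow> real"
  assumes K: "\<And>e. e \<in> E \<Longrightarrow> 0 < K e" and fin: "finite E"
    and inj: "\<And>x. (\<And>e. e \<in> E \<Longrightarrow> (\<Sum>i\<in>S. A e i * x i) = 0) \<Longrightarrow> \<forall>i\<in>S. x i = 0"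
  shows "pos_def_on S (\<lambda>i j. \<Sum>e\<in>E. K e * A e i * A e j)"
  unfolding pos_def_on_def
proof (intro allI impI)
  fix x :: "'a \<Rightarrow> real" assume x: "\<exists>i\<in>S. x i \<noteq> 0"
  have "(\<Sum>i\<in>S. \<Sum>j\<in>S. x i * (\<Sum>e\<in>E. K e * A e i * A e j) * x j)
      = (\<Sum>i\<in>S. \<Sum>j\<in>S. \<Sum>e\<in>E. K e * (A e i * x i) * (A e j * x j))"
    by (simp add: sum_distrib_left sum_distrib_right mult_ac)
  also have "\<dots> = (\<Sum>i\<in>S. \<Sum>e\<in>E. \<Sum>j\<in>S. K e * (A e i * x i) * (A e j * x j))"
    by (intro sum.cong refl sum.swap)
  also have "\<dots> = (\<Sum>e\<in>E. \<Sum>i\<in>S. \<Sum>j\<in>S. K e * (A e i * x i) * (A e j * x j))"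
    by (rule sum.swap)
  also have "\<dots> = (\<Sum>e\<in>E. K e * (\<Sum>i\<in>S. A e i * x i)\<^sup>2)"
    by (simp add: power2_eq_square sum_product) (simp add: sum_distrib_left mult.assoc)
  also have "\<dots> > 0"
  proof -
    obtain e where "e \<in> E" "(\<Sum>i\<in>S. A e i * x i) \<noteq> 0" using inj x by blast
    then show ?thesis
      using K fin by (intro sum_pos2[of E e]) (auto simp: less_imp_le)
  qed
  finally show "0 < (\<Sum>i\<in>S. \<Sum>j\<in>S. x i * (\<Sum>e\<in>E. K e * A e i * A e j) * x j)" .
qed

text \<open>Were \<open>S\<close> larger, padding \<open>M\<close> with zero rows to a square matrix
  would make the determinant vanish and yield a nonzero kernel vector.\<close>

lemma card_le_if_injective:
  fixes M :: "'b \<Rightarrow> 'a \<Rightarrow> real"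
  assumes fin: "finite S" "finite T"
    and inj: "\<And>x. (\<And>t. t \<in> T \<Longrightarrow> (\<Sum>s\<in>S. M t s * x s) = 0) \<Longrightarrow> \<forall>s\<in>S. x s = 0"
  shows "card S \<le> card T"
proof (rule ccontr)
  assume "\<not> card S \<le> card T"
  then have lt: "card T < card S" by simp
  then obtain g where g: "inj_on g T" "g ` T \<subset> S"
    using fin by (metis card_image card_le_inj less_imp_le psubsetI nat_less_le)
  then obtain r where r: "r \<in> S" "r \<notin> g ` T" by auto
  define N where "N s s' = (if s \<in> g ` T then M (inv_into T g s) s' else 0)" for s s'
  have pd: "(\<Prod>i\<in>S. N i (p i)) = 0" for p
    using r fin(1) by (intro prod_zero) (auto simp: N_def intro!: bexI[of _ r])
  have "det_on S N = 0" by (simp add: det_on_def pd)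
  then obtain x where x: "\<exists>i\<in>S. x i \<noteq> 0" "\<And>i. i \<in> S \<Longrightarrow> (\<Sum>j\<in>S. N i j * x j) = 0"
    using det_on_eq_0_kernel[OF fin(1)] by blast
  have "(\<Sum>s\<in>S. M t s * x s) = 0" if "t \<in> T" for t
    using x(2)[of "g t"] that g by (auto simp: N_def)
  then show False using inj x(1) by blast
qed

text \<open>Integrality turns a nonzero determinant into one whose square is at least 1.\<close>

lemma det_on_int:
  assumes "\<And>i j. i \<in> S \<Longrightarrow> j \<in> S \<Longrightarrow> M i j \<in> \<int>"
  shows "det_on S M \<in> \<int>"
  unfolding det_on_def
  by (intro Ints_sum Ints_mult Ints_prod) (auto simp: assms permutes_in_image)

lemma det_on_scale_rows:
  fixes M :: "'a \<Rightarrow> 'a \<Rightarrow> real"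
  shows "det_on S (\<lambda>i j. k i * M i j) = (\<Prod>i\<in>S. k i) * det_on S M"
  by (simp add: det_on_def prod.distrib sum_distrib_left mult_ac)

lemma det_on_scale:
  fixes M :: "'a \<Rightarrow> 'a \<Rightarrow> real"
  shows "det_on S (\<lambda>i j. k * M i j) = k ^ card S * det_on S M"
  by (simp add: det_on_scale_rows)

text \<open>
  The square matrices $R$ with rows the unit vectors of $X$ and $g^T$, and $N=[a\,|\,K^{-1}g]$, make $RN$ block
  triangular and $N^TKN$ block diagonal; comparing determinants gives the identity.
\<close>

lemma det_gram_duality:
  fixes a g :: "'e \<Rightarrow> 'e \<Rightarrow> real" and K :: "'e \<Rightarrow> real"
  assumes fin: "finite X" "finite Y" and disj: "X \<inter> Y = {}"
    and K: "\<And>e. e \<in> X \<union> Y \<Longrightarrow> K e \<noteq> 0"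
    and orth: "\<And>c y. c \<in> X \<Longrightarrow> y \<in> Y \<Longrightarrow> (\<Sum>e\<in>X \<union> Y. a e c * g e y) = 0"
    and unit: "det_on Y (\<lambda>y e. g e y) = 1"
    and nz: "det_on Y (\<lambda>y y'. \<Sum>e\<in>X \<union> Y. g e y * g e y' / K e) \<noteq> 0"
  shows "det_on X (\<lambda>c c'. \<Sum>e\<in>X \<union> Y. K e * a e c * a e c')
       = (det_on X a)\<^sup>2 * (\<Prod>e\<in>X \<union> Y. K e) * det_on Y (\<lambda>y y'. \<Sum>e\<in>X \<union> Y. g e y * g e y' / K e)"
proof -
  let ?U = "X \<union> Y"
  have finU: "finite ?U" using fin by simp
  define G where "G y y' = (\<Sum>e\<in>?U. g e y * g e y' / K e)" for y y'
  define R where "R r e = (if r \<in> X then if r = e then 1 else 0 else g e r)" for r e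
  define N where "N e s = (if s \<in> X then a e s else g e s / K e)" for e s
  have YX: "y \<notin> X" if "y \<in> Y" for y using disj that by auto
  have "det_on (Y \<union> X) R = det_on Y R * det_on X R"
    by (rule det_on_block_triangular) (use fin disj YX in \<open>auto simp: R_def\<close>)
  moreover have "det_on X R = 1"
    by (rule det_on_unit_triangular[where ht = "\<lambda>_. 0"]) (use fin in \<open>auto simp: R_def\<close>)
  moreover have "det_on Y R = 1"
    unfolding unit[symmetric] by (rule det_on_cong) (use YX in \<open>auto simp: R_def\<close>)
  ultimately have R: "det_on ?U R = 1" by (simp add: Un_commute)
  have "det_on ?U (\<lambda>r s. \<Sum>e\<in>?U. R r e * N e s)
      = det_on X (\<lambda>r s. \<Sum>e\<in>?U. R r e * N e s) * det_on Y (\<lambda>r s. \<Sum>e\<in>?U. R r e * N e s)"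
  proof (rule det_on_block_triangular[OF fin disj])
    fix i j assume "i \<in> Y" "j \<in> X"
    then show "(\<Sum>e\<in>?U. R i e * N e j) = 0"
      using orth[of j i] YX[of i] by (simp add: R_def N_def mult.commute)
  qed
  also have "det_on X (\<lambda>r s. \<Sum>e\<in>?U. R r e * N e s) = det_on X a"
  proof (rule det_on_cong)
    fix i j assume ij: "i \<in> X" "j \<in> X"
    have "(\<Sum>e\<in>?U. R i e * N e j) = (\<Sum>e\<in>?U. if i = e then N e j else 0)"
      by (intro sum.cong refl) (use ij in \<open>auto simp: R_def\<close>)
    then show "(\<Sum>e\<in>?U. R i e * N e j) = a i j"
      using finU ij by (simp add: N_def)
  qed
  also have "det_on Y (\<lambda>r s. \<Sum>e\<in>?U. R r e * N e s) = det_on Y G"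
    by (rule det_on_cong) (auto simp: R_def N_def G_def YX)
  also have "det_on ?U (\<lambda>r s. \<Sum>e\<in>?U. R r e * N e s) = det_on ?U N"
    by (simp add: det_on_mult[OF finU] R)
  finally have detN: "det_on ?U N = det_on X a * det_on Y G" .
  have "det_on ?U (\<lambda>s t. \<Sum>e\<in>?U. N e s * (K e * N e t)) = (\<Prod>e\<in>?U. K e) * (det_on ?U N)\<^sup>2"
    using det_on_mult[OF finU, of "\<lambda>s e. N e s" "\<lambda>e t. K e * N e t"]
    by (simp add: det_on_scale_rows det_on_transpose[OF finU, of N] power2_eq_square mult_ac)
  moreover have "det_on ?U (\<lambda>s t. \<Sum>e\<in>?U. N e s * (K e * N e t))
     = det_on X (\<lambda>s t. \<Sum>e\<in>?U. N e s * (K e * N e t)) * det_on Y (\<lambda>s t. \<Sum>e\<in>?U. N e s * (K e * N e t))"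
  proof (rule det_on_block_triangular[OF fin disj])
    fix i j assume ij: "i \<in> Y" "j \<in> X"
    have "(\<Sum>e\<in>?U. N e i * (K e * N e j)) = (\<Sum>e\<in>?U. a e j * g e i)"
      by (intro sum.cong refl) (use ij YX K in \<open>auto simp: N_def\<close>)
    then show "(\<Sum>e\<in>?U. N e i * (K e * N e j)) = 0"
      using orth ij by simp
  qed
  moreover have "det_on X (\<lambda>s t. \<Sum>e\<in>?U. N e s * (K e * N e t))
      = det_on X (\<lambda>c c'. \<Sum>e\<in>?U. K e * a e c * a e c')"
    by (rule det_on_cong) (auto simp: N_def mult_ac)
  moreover have "det_on Y (\<lambda>s t. \<Sum>e\<in>?U. N e s * (K e * N e t)) = det_on Y G"
    by (rule det_on_cong) (auto simp: N_def G_def YX K intro!: sum.cong)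
  ultimately have "det_on X (\<lambda>c c'. \<Sum>e\<in>?U. K e * a e c * a e c') * det_on Y G
      = (\<Prod>e\<in>?U. K e) * (det_on X a * det_on Y G)\<^sup>2"
    unfolding detN by simp
  moreover have "det_on Y G \<noteq> 0" using nz by (simp add: G_def[abs_def])
  ultimately have "det_on X (\<lambda>c c'. \<Sum>e\<in>?U. K e * a e c * a e c')
      = (det_on X a)\<^sup>2 * (\<Prod>e\<in>?U. K e) * det_on Y G"
    by (simp add: power2_eq_square)
  then show ?thesis by (simp add: G_def[abs_def])
qed

section \<open>Discrete calculus on the square lattice\<close>

type_synonym site = "int \<times> int"

fun fwd :: "bool \<Rightarrow> site \<Rightarrow> site" where
  "fwd False (a, b) = (a + 1, b)"
| "fwd True (a, b) = (a, b + 1)"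

fun bwd :: "bool \<Rightarrow> site \<Rightarrow> site" where
  "bwd False (a, b) = (a - 1, b)"
| "bwd True (a, b) = (a, b - 1)"

lemma bwd_fwd [simp]: "bwd d (fwd d v) = v" "fwd d (bwd d v) = v"
  by (cases d; cases v; simp)+

lemma fwd_ne [simp]: "fwd d v \<noteq> v" "v \<noteq> fwd d v" "bwd d v \<noteq> v" "v \<noteq> bwd d v"
  by (cases d; cases v; simp)+

lemma fwd_commute: "fwd d (fwd d' v) = fwd d' (fwd d v)"
  by (cases d; cases d'; cases v; simp)

text \<open>Plaquettes are indexed by their lower left corner.\<close>

definition full :: "site set \<Rightarrow> site set" where
  "full J = {v. v \<in> J \<and> fwd False v \<in> J \<and> fwd True v \<in> J \<and> fwd True (fwd False v) \<in> J}"

definition touching :: "site set \<Rightarrow> site set" where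
  "touching J = {v. v \<in> J \<or> fwd False v \<in> J \<or> fwd True v \<in> J \<or> fwd True (fwd False v) \<in> J}"

text \<open>The pair \<open>(v, d)\<close> stands for the bond from \<open>v\<close> to \<open>fwd d v\<close>, vertical iff \<open>d\<close>.
  Its adjacent plaquettes are \<open>v\<close> and \<open>bwd (\<not> d) v\<close>.\<close>

definition bonds :: "site set \<Rightarrow> (site \<times> bool) set" where
  "bonds J = {(v, d). v \<in> J \<and> fwd d v \<in> J}"

definition bonds_meeting :: "site set \<Rightarrow> (site \<times> bool) set" where
  "bonds_meeting J = {(v, d). v \<in> J \<or> fwd d v \<in> J}"

text \<open>The signed incidence matrix of the whole lattice. For a boundary bond only one nonzero
  column lies in \<open>J\<close>, which produces the Dirichlet condition.\<close>

fun grad :: "site \<times> bool \<Rightarrow> site \<Rightarrow> real" where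
  "grad (v, d) u = of_bool (u = fwd d v) - of_bool (u = v)"

text \<open>The signs orient each plaquette counter-clockwise, with bonds directed by
  \<open>fwd\<close>, so that the curl of a gradient vanishes.\<close>

fun curl :: "site \<times> bool \<Rightarrow> site \<Rightarrow> real" where
  "curl (v, d) x = (if d then -1 else 1) * (of_bool (x = v) - of_bool (x = bwd (\<not> d) v))"

lemma full_subset: "full J \<subseteq> J"
  by (auto simp: full_def)

lemma bonds_subset: "bonds J \<subseteq> bonds_meeting J"
  by (auto simp: bonds_def bonds_meeting_def)

lemma finite_full: "finite J \<Longrightarrow> finite (full J)"
  using full_subset finite_subset by blast

lemma finite_bonds_meeting:
  assumes "finite J" shows "finite (bonds_meeting J)"
proof (rule finite_subset)
  show "bonds_meeting J \<subseteq> (J \<union> bwd False ` J \<union> bwd True ` J) \<times> UNIV"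
  proof (rule subrelI)
    fix v d assume "(v, d) \<in> bonds_meeting J"
    then have "v \<in> J \<or> v \<in> bwd d ` J"
      by (auto simp: bonds_meeting_def) (metis bwd_fwd(1) image_eqI)
    then show "(v, d) \<in> (J \<union> bwd False ` J \<union> bwd True ` J) \<times> UNIV"
      by (cases d) auto
  qed
  show "finite ((J \<union> bwd False ` J \<union> bwd True ` J) \<times> (UNIV :: bool set))"
    using assms by auto
qed

lemma finite_bonds: "finite J \<Longrightarrow> finite (bonds J)"
  using bonds_subset finite_bonds_meeting finite_subset by blast

lemma sum_grad:
  assumes "finite J" and "v \<in> J" "fwd d v \<in> J"
  shows "(\<Sum>u\<in>J. grad (v, d) u * \<phi> u) = \<phi> (fwd d v) - \<phi> v"
proof -
  have "(\<Sum>u\<in>J. grad (v, d) u * \<phi> u)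
      = (\<Sum>u\<in>J. (if u = fwd d v then \<phi> u else 0) - (if u = v then \<phi> u else 0))"
    by (intro sum.cong refl) (simp add: of_bool_def left_diff_distrib)
  then show ?thesis using assms by (simp add: sum_subtractf)
qed

lemma curl_grad_sum:
  assumes fin: "finite F" and face: "\<And>e. curl e x \<noteq> 0 \<Longrightarrow> e \<in> F"
  shows "(\<Sum>e\<in>F. curl e x * h e)
    = h (x, False) + h (fwd False x, True) - h (fwd True x, False) - h (x, True)"
proof -
  let ?X = "{(x, False), (fwd False x, True), (fwd True x, False), (x, True)}"
  have "?X \<subseteq> F" by (auto intro!: face simp: of_bool_def; cases x; simp)
  moreover have "curl e x = 0" if "e \<notin> ?X" for e
  proof -
    obtain a b d p r where "e = ((a, b), d)" "x = (p, r)" by (metis surj_pair)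
    then show ?thesis using that by (cases d) auto
  qed
  ultimately have "(\<Sum>e\<in>F. curl e x * h e) = (\<Sum>e\<in>?X. curl e x * h e)"
    using fin by (intro sum.mono_neutral_right) auto
  also have "\<dots> = h (x, False) + h (fwd False x, True) - h (fwd True x, False) - h (x, True)"
    by (cases x) (simp add: of_bool_def)
  finally show ?thesis .
qed

lemma div_sum:
  assumes fin: "finite F" and inc: "\<And>e. grad e u \<noteq> 0 \<Longrightarrow> e \<notin> F \<Longrightarrow> y e = 0"
  shows "(\<Sum>e\<in>F. grad e u * y e)
    = y (bwd False u, False) + y (bwd True u, True) - y (u, False) - y (u, True)"
proof -
  let ?X = "{(bwd False u, False), (bwd True u, True), (u, False), (u, True)}"
  have zero: "grad e u = 0" if "e \<notin> ?X" for e
  proof -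
    obtain a b d p r where "e = ((a, b), d)" "u = (p, r)" by (metis surj_pair)
    then show ?thesis using that by (cases d) auto
  qed
  have "(\<Sum>e\<in>F. grad e u * y e) = (\<Sum>e\<in>?X. grad e u * y e)"
  proof (rule sum.mono_neutral_cong)
    show "finite F" "finite ?X" using fin by auto
    fix i
    show "grad i u * y i = 0" if "i \<in> ?X - F" using inc[of i] that by (cases "grad i u = 0") auto
    show "grad i u * y i = 0" if "i \<in> F - ?X" using zero[of i] that by simp
  qed simp
  also have "\<dots> = y (bwd False u, False) + y (bwd True u, True) - y (u, False) - y (u, True)"
    by (cases u) (simp add: of_bool_def)
  finally show ?thesis .
qed

text \<open>Discrete Poincare lemma: \<open>\<psi>\<close> adds up the horizontal flow along each
  column from below the support, and the formula for the vertical flow follows from zero divergence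
  by induction on the height.\<close>

lemma stream_function:
  fixes y :: "site \<times> bool \<Rightarrow> real"
  assumes fin: "finite {e. y e \<noteq> 0}"
    and div: "\<And>u. y (bwd False u, False) + y (bwd True u, True) = y (u, False) + y (u, True)"
  obtains \<psi> where "\<And>v. y (v, False) = \<psi> v - \<psi> (bwd True v)"
    and "\<And>v. y (v, True) = \<psi> (bwd False v) - \<psi> v"
proof -
  obtain m :: int where m: "y ((a, k), d) = 0" if "k \<le> m" for a k d
  proof -
    have "bdd_below ((\<lambda>e. snd (fst e)) ` {e. y e \<noteq> 0})"
      using fin by (intro bdd_below_finite finite_imageI)
    then obtain m where "\<forall>k\<in>(\<lambda>e. snd (fst e)) ` {e. y e \<noteq> 0}. m \<le> k"
      unfolding bdd_below_def by blast
    then have m: "\<And>e. y e \<noteq> 0 \<Longrightarrow> m \<le> snd (fst e)" by blast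
    \<comment> \<open>The lower bound \<open>m\<close> may be attained, whereas \<open>y\<close> has
      to vanish at the chosen level itself.\<close>
    show thesis
      by (rule that[of "m - 1"]) (use m in force)
  qed
  define \<psi> where "\<psi> = (\<lambda>(a, b). \<Sum>k\<in>{m<..b}. y ((a, k), False))"
  have H: "y ((a, b), False) = \<psi> (a, b) - \<psi> (a, b - 1)" for a b
  proof (cases "m < b")
    case True
    then have "{m<..b} = insert b {m<..b - 1}" by auto
    then show ?thesis by (simp add: \<psi>_def)
  qed (simp add: \<psi>_def m)
  have V: "y ((a, b), True) = \<psi> (a - 1, b) - \<psi> (a, b)" for a b
  proof (cases "m \<le> b")
    case True
    then show ?thesis
    proof (induction b rule: int_ge_induct)
      case base
      then show ?case by (simp add: \<psi>_def m)
    next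
      case (step b)
      show ?case
        using step div[of "(a, b + 1)"] H[of a "b + 1"] H[of "a - 1" "b + 1"] by simp
    qed
  qed (simp add: \<psi>_def m)
  show thesis
    by (rule that[of \<psi>]; case_tac v; simp add: H V)
qed

text \<open>Connectedness is stated for functions, the form in which it is used: a function that
  agrees across each admissible bond is constant. \<open>dual_connected\<close> carries the planar
  topology: crossing boundary bonds leads from any incomplete plaquette touching \<open>J\<close> to
  any other.\<close>

locale lattice_domain =
  fixes J :: "site set"
  assumes finite_J: "finite J"
    and connected: "\<And>\<phi> :: site \<Rightarrow> real. (\<And>v d. (v, d) \<in> bonds J \<Longrightarrow> \<phi> (fwd d v) = \<phi> v) \<Longrightarrow>
         u \<in> J \<Longrightarrow> w \<in> J \<Longrightarrow> \<phi> u = \<phi> w"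
    and dual_connected: "\<And>\<psi> :: site \<Rightarrow> real. (\<And>v d. (v, d) \<in> bonds_meeting J - bonds J \<Longrightarrow> \<psi> v = \<psi> (bwd (\<not> d) v)) \<Longrightarrow>
         x \<in> touching J - full J \<Longrightarrow> x' \<in> touching J - full J \<Longrightarrow> \<psi> x = \<psi> x'"
begin

lemma finite_sets: "finite (full J)" "finite (bonds J)" "finite (bonds_meeting J)"
  using finite_full finite_bonds finite_bonds_meeting finite_J by auto

lemma bond_sides_touching:
  assumes "(v, d) \<in> bonds_meeting J" 
  shows "v \<in> touching J" "bwd (\<not> d) v \<in> touching J"
  using assms by (cases d; cases v; auto simp: bonds_meeting_def touching_def)+

lemma curl_full_bonds:
  assumes "x \<in> full J" "curl e x \<noteq> 0"
  shows "e \<in> bonds J"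
proof -
  obtain v d where e: "e = (v, d)" by (cases e)
  have "x = v \<or> x = bwd (\<not> d) v" using assms(2) by (auto simp: e split: if_splits)
  then show ?thesis using assms(1)
    by (cases d; cases x; cases v; auto simp: e full_def bonds_def)
qed

section \<open>Complementary spanning trees and Euler's relation\<close>

definition bottoms :: "(site \<times> bool) set" where
  "bottoms = (\<lambda>x. (x, False)) ` full J"

lemma bottoms_subset: "bottoms \<subseteq> bonds J"
  by (auto simp: bottoms_def bonds_def full_def)

lemma card_bottoms: "card bottoms = card (full J)"
  unfolding bottoms_def by (rule card_image) (auto simp: inj_on_def)

context
  fixes e0 assumes e0: "e0 \<in> bonds_meeting J - bonds J"
begin

text \<open>The bottom bonds of the full plaquettes form a spanning tree of the dual graph; their
  complement, grounded through the boundary bond \<open>e0\<close>, is a spanning tree of the wired graph.\<close>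

definition cotree :: "(site \<times> bool) set" where
  "cotree = insert e0 (bonds J - bottoms)"

lemma finite_cotree: "finite cotree"
  using finite_sets by (simp add: cotree_def)

lemma cotree_bottoms: "cotree \<union> bottoms = insert e0 (bonds J)" "cotree \<inter> bottoms = {}"
  using bottoms_subset e0 by (auto simp: cotree_def)

text \<open>The left and right sides of a full plaquette lie in \<open>cotree\<close>, so
  \<open>\<phi>\<close> has the same increment along its bottom as along its top, and the top is a
  cotree bond or the bottom of the next full plaquette. Induction from the highest row down makes
  \<open>\<phi>\<close> constant, and \<open>e0\<close> makes the constant zero.\<close>

lemma grad_injective:
  assumes zero: "\<And>e. e \<in> cotree \<Longrightarrow> (\<Sum>u\<in>J. grad e u * \<phi> u) = 0"
  shows "\<forall>u\<in>J. \<phi> u = 0"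
proof -
  have cot: "\<phi> (fwd d v) = \<phi> v" if "(v, d) \<in> bonds J" "(v, d) \<notin> bottoms" for v d
    using zero[of "(v, d)"] that sum_grad[OF finite_J, of v d \<phi>]
    by (auto simp: cotree_def bonds_def)
  obtain m :: int where m: "\<And>v. v \<in> full J \<Longrightarrow> snd v \<le> m"
    using finite_sets(1) by (meson bdd_above.E bdd_above_finite finite_imageI image_eqI)
  have "\<forall>v. v \<in> full J \<longrightarrow> k = nat (m - snd v) \<longrightarrow> \<phi> (fwd False v) = \<phi> v" for k
  proof (induction k rule: less_induct)
    case (less k)
    show ?case
    proof (intro allI impI)
      fix v assume v: "v \<in> full J" "k = nat (m - snd v)"
      have left: "\<phi> (fwd True v) = \<phi> v"
        by (rule cot) (use v in \<open>auto simp: full_def bonds_def bottoms_def\<close>)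
      have right: "\<phi> (fwd True (fwd False v)) = \<phi> (fwd False v)"
        by (rule cot) (use v in \<open>auto simp: full_def bonds_def bottoms_def\<close>)
      have top: "\<phi> (fwd False (fwd True v)) = \<phi> (fwd True v)"
      proof (cases "fwd True v \<in> full J")
        case True
        have "snd (fwd True v) = snd v + 1" by (cases v) simp
        with True have "nat (m - snd (fwd True v)) < k"
          using m[of "fwd True v"] v by auto
        then show ?thesis using less.IH True by blast
      next
        case False
        then show ?thesis
          by (intro cot) (use v in \<open>auto simp: full_def bonds_def bottoms_def fwd_commute\<close>)
      qed
      show "\<phi> (fwd False v) = \<phi> v"
        using left right top by (simp add: fwd_commute)
    qed
  qed
  then have all: "\<phi> (fwd d v) = \<phi> v" if "(v, d) \<in> bonds J" for v d
    using cot that by (cases "(v, d) \<in> bottoms") (auto simp: bottoms_def)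
  obtain v d where vd: "e0 = (v, d)" by (cases e0)
  \<comment> \<open>\<open>r\<close> is the only end of \<open>e0\<close> in \<open>J\<close>; the
    other end is absent from the sum, as if held at potential zero.\<close>
  define r where "r = (if v \<in> J then v else fwd d v)"
  have r: "r \<in> J" using e0 by (auto simp: vd r_def bonds_meeting_def)
  have "(\<Sum>u\<in>J. grad e0 u * \<phi> u) = (\<Sum>u\<in>J. if u = r then grad e0 r * \<phi> r else 0)"
    by (intro sum.cong refl) (use e0 in \<open>auto simp: vd r_def bonds_def bonds_meeting_def of_bool_def\<close>)
  also have "\<dots> = grad e0 r * \<phi> r" using finite_J r by simp
  finally have "grad e0 r * \<phi> r = 0" using zero[of e0] by (simp add: cotree_def)
  moreover have "grad e0 r \<noteq> 0" by (auto simp: vd r_def)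
  ultimately have "\<phi> r = 0" by simp
  then show ?thesis using connected[OF all r] by metis
qed

text \<open>A divergence-free function on the bonds of \<open>J\<close> has a stream function, which is
  constant on the incomplete plaquettes because the contour passes through all of them.\<close>

lemma div_injective:
  assumes zero: "\<And>u. u \<in> J \<Longrightarrow> (\<Sum>e\<in>cotree. grad e u * y e) = 0"
  shows "\<forall>e\<in>cotree. y e = 0"
proof -
  obtain v0 d0 where vd: "e0 = (v0, d0)" by (cases e0)
  define r where "r = (if v0 \<in> J then v0 else fwd d0 v0)"
  have r: "r \<in> J" using e0 by (auto simp: vd r_def bonds_meeting_def)
  \<comment> \<open>Summed over \<open>J\<close>, the contributions of interior bonds cancel, so
    only the flow through \<open>e0\<close> is left.\<close>
  have "(\<Sum>u\<in>J. \<Sum>e\<in>cotree. grad e u * y e) = 0" using zero by simp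
  also have "(\<Sum>u\<in>J. \<Sum>e\<in>cotree. grad e u * y e) = (\<Sum>e\<in>cotree. (\<Sum>u\<in>J. grad e u * 1) * y e)"
    by (subst sum.swap) (simp add: sum_distrib_right)
  also have "\<dots> = (\<Sum>e\<in>cotree. if e = e0 then (\<Sum>u\<in>J. grad e0 u) * y e0 else 0)"
    using sum_grad[OF finite_J, where \<phi> = "\<lambda>_. 1"]
    by (intro sum.cong refl) (auto simp: cotree_def bonds_def)
  also have "\<dots> = (\<Sum>u\<in>J. grad e0 u) * y e0"
    using finite_cotree by (simp add: cotree_def)
  also have "(\<Sum>u\<in>J. grad e0 u) = (\<Sum>u\<in>J. if u = r then grad e0 r else 0)"
    by (intro sum.cong refl) (use e0 in \<open>auto simp: vd r_def bonds_def bonds_meeting_def of_bool_def\<close>)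
  also have "\<dots> = grad e0 r" using finite_J r by simp
  finally have "grad e0 r * y e0 = 0" .
  moreover have "grad e0 r \<noteq> 0" by (auto simp: vd r_def)
  ultimately have y0: "y e0 = 0" by simp
  \<comment> \<open>Extended by zero, the flow is divergence-free on the whole lattice, so a global
    stream function exists.\<close>
  define z where "z e = (if e \<in> bonds J - bottoms then y e else 0)" for e
  have zsum: "(\<Sum>e\<in>cotree. grad e u * y e) = (\<Sum>e\<in>bonds J. grad e u * z e)" for u
    using finite_sets(2) finite_cotree y0
    by (intro sum.mono_neutral_cong) (auto simp: z_def cotree_def)
  have "z (bwd False u, False) + z (bwd True u, True) = z (u, False) + z (u, True)" for u
  proof (cases "u \<in> J")
    case True
    then show ?thesis
      using div_sum[OF finite_sets(2), of u z] zero[OF True] zsum[of u] by (simp add: z_def)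
  next
    case False
    then show ?thesis by (simp add: z_def bonds_def)
  qed
  moreover have "finite {e. z e \<noteq> 0}"
    by (rule finite_subset[OF _ finite_sets(2)]) (auto simp: z_def split: if_splits)
  ultimately obtain \<psi> where \<psi>: "\<And>v. z (v, False) = \<psi> v - \<psi> (bwd True v)"
      "\<And>v. z (v, True) = \<psi> (bwd False v) - \<psi> v"
    using stream_function[of z] by blast
  have side: "\<psi> v = \<psi> (bwd (\<not> d) v)" if "z (v, d) = 0" for v d
    using \<psi>[of v] that by (cases d) auto
  have "\<exists>k. \<forall>x\<in>touching J - full J. \<psi> x = k"
  proof (cases "touching J - full J = {}")
    case False
    then obtain x where x: "x \<in> touching J - full J" by blast
    have "\<psi> x' = \<psi> x" if "x' \<in> touching J - full J" for x'
      by (rule dual_connected[OF _ that x]) (rule side, auto simp: z_def)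
    then show ?thesis by blast
  next
    case True
    then show ?thesis by blast
  qed
  then obtain k where k: "\<And>x. x \<in> touching J - full J \<Longrightarrow> \<psi> x = k" by blast
  obtain m :: int where m: "\<And>v. v \<in> full J \<Longrightarrow> m \<le> snd v"
    using finite_sets(1) by (meson bdd_below.E bdd_below_finite finite_imageI image_eqI)
  \<comment> \<open>A bottom bond carries no flow, so \<open>\<psi>\<close> agrees on a full
    plaquette and the one below it; descending a column ends at an incomplete plaquette, where the
    value is \<open>k\<close>.\<close>
  have "\<forall>v. v \<in> full J \<longrightarrow> n = nat (snd v - m) \<longrightarrow> \<psi> v = k" for n
  proof (induction n rule: less_induct)
    case (less n)
    show ?case
    proof (intro allI impI)
      fix v assume v: "v \<in> full J" "n = nat (snd v - m)"
      have "\<psi> v = \<psi> (bwd True v)"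
        using side[of v False] v by (simp add: z_def bottoms_def)
      also have "\<dots> = k"
      proof (cases "bwd True v \<in> full J")
        case True
        have "snd (bwd True v) = snd v - 1" by (cases v) simp
        with True have "nat (snd (bwd True v) - m) < n"
          using m[of "bwd True v"] v by auto
        then show ?thesis using less.IH True by blast
      next
        case False
        moreover have "bwd True v \<in> touching J"
          using v full_subset by (auto simp: touching_def)
        ultimately show ?thesis using k by blast
      qed
      finally show "\<psi> v = k" .
    qed
  qed
  then have const: "\<psi> x = k" if "x \<in> touching J" for x
    using k that by blast
  have "z (v, d) = 0" if "(v, d) \<in> bonds J" for v d
  proof -
    have "(v, d) \<in> bonds_meeting J" using that bonds_subset by blast
    then have "\<psi> v = k" "\<psi> (bwd (\<not> d) v) = k"
      using const bond_sides_touching by blast+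
    then show ?thesis using \<psi>[of v] by (cases d) auto
  qed
  then have z0: "z e = 0" if "e \<in> bonds J" for e using that by (cases e) blast
  show ?thesis
  proof
    fix e assume "e \<in> cotree"
    then show "y e = 0" using y0 z0[of e] by (auto simp: cotree_def z_def)
  qed
qed

text \<open>The gradient matrix between \<open>cotree\<close> and \<open>J\<close> and its transpose
  are both injective. With the partition of \<open>insert e0 (bonds J)\<close> into
  \<open>cotree\<close> and \<open>bottoms\<close> this yields Euler's relation.\<close>

lemma card_cotree: "card cotree = card J"
proof (rule antisym)
  show "card J \<le> card cotree"
    by (rule card_le_if_injective[OF finite_J finite_cotree, where M = grad]) (rule grad_injective)
  show "card cotree \<le> card J"
    by (rule card_le_if_injective[OF finite_cotree finite_J, where M = "\<lambda>u e. grad e u"])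
      (rule div_injective)
qed

lemma euler: "card J + card (full J) = card (bonds J) + 1"
proof -
  have "card cotree + card bottoms = card (insert e0 (bonds J))"
    unfolding cotree_bottoms(1)[symmetric]
    by (rule card_Un_disjoint[symmetric]) (use finite_cotree cotree_bottoms(2) bottoms_subset finite_sets finite_subset in auto)
  then show ?thesis using e0 finite_sets by (simp add: card_cotree card_bottoms)
qed

end

end

section \<open>Determinants under the duality shift\<close>

lemma grad_Ints: "grad e u \<in> \<int>"
  by (cases e) (simp add: of_bool_def)

text \<open>Makes bonds outside \<open>bonds J\<close> enter the Dirichlet matrix only through its
  diagonal.\<close>

lemma grad_outside:
  assumes "u \<in> J" "w \<in> J" "u \<noteq> w" "e \<notin> bonds J"
  shows "grad e u * grad e w = 0"
  using assms by (cases e) (auto simp: bonds_def of_bool_def)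

lemma grad_bonds_meeting: "u \<in> J \<Longrightarrow> grad e u \<noteq> 0 \<Longrightarrow> e \<in> bonds_meeting J"
  by (cases e) (auto simp: bonds_meeting_def of_bool_def split: if_splits)

lemma grad_square_sum:
  assumes "finite F" "\<And>e. grad e v \<noteq> 0 \<Longrightarrow> e \<in> F"
  shows "(\<Sum>e\<in>F. grad e v * grad e v) = 4"
  by (subst div_sum[where y = "\<lambda>e. grad e v"]) (use assms in \<open>auto simp: of_bool_def\<close>)

text \<open>The bond whose dual, shifted by $(-\frac12,-\frac12)$, is the given bond.\<close>

fun shift :: "site \<times> bool \<Rightarrow> site \<times> bool" where
  "shift (v, d) = (fwd d v, \<not> d)"

fun unshift :: "site \<times> bool \<Rightarrow> site \<times> bool" where
  "unshift (v, d) = (bwd (\<not> d) v, \<not> d)"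

lemma shift_unshift [simp]: "shift (unshift e) = e" "unshift (shift e) = e"
  by (cases e; simp)+

lemma inj_shift: "inj_on shift S"
  by (rule inj_on_inverseI[where g = unshift]) simp

text \<open>Rotating a bond turns its row of \<open>grad\<close> into a row of \<open>curl\<close>
  up to sign, and the sign drops out of a product of two entries.\<close>

lemma curl_shift: "curl (shift e) u * curl (shift e) w = grad e u * grad e w"
  by (cases e; cases "snd e") (auto simp: of_bool_def)

definition weight :: "real \<Rightarrow> 'e set \<Rightarrow> 'e \<Rightarrow> real" where
  "weight q A e = (if e \<in> A then q else 1)"

section \<open>Dirichlet and dual Laplacians of a lattice domain\<close>

context lattice_domain
begin

definition dirichlet :: "(site \<times> bool \<Rightarrow> real) \<Rightarrow> site \<Rightarrow> site \<Rightarrow> real" where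
  "dirichlet c u w = (\<Sum>e\<in>bonds_meeting J. c e * grad e u * grad e w)"

text \<open>Reciprocal conductances, as in the dual network. Incomplete plaquettes have no row and
  act as grounded dual vertices.\<close>

definition dual_laplacian :: "(site \<times> bool \<Rightarrow> real) \<Rightarrow> site \<Rightarrow> site \<Rightarrow> real" where
  "dual_laplacian c x x' = (\<Sum>e\<in>bonds J. curl e x * curl e x' / c e)"

text \<open>A bottom bond gives its full plaquette the value of the one below, or zero if that one
  is incomplete; descending a column ends at zero.\<close>

lemma curl_injective:
  assumes zero: "\<And>e. e \<in> bonds J \<Longrightarrow> (\<Sum>x\<in>full J. curl e x * \<psi> x) = 0"
  shows "\<forall>x\<in>full J. \<psi> x = 0"
proof -
  obtain m :: int where m: "\<And>v. v \<in> full J \<Longrightarrow> m \<le> snd v"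
    using finite_sets(1) by (meson bdd_below.E bdd_below_finite finite_imageI image_eqI)
  have "\<forall>v. v \<in> full J \<longrightarrow> n = nat (snd v - m) \<longrightarrow> \<psi> v = 0" for n
  proof (induction n rule: less_induct)
    case (less n)
    show ?case
    proof (intro allI impI)
      fix v assume v: "v \<in> full J" "n = nat (snd v - m)"
      have "(v, False) \<in> bonds J" using v by (auto simp: full_def bonds_def)
      then have "0 = (\<Sum>x\<in>full J. curl (v, False) x * \<psi> x)" by (simp only: zero)
      also have "\<dots> = (\<Sum>x\<in>full J. (if x = v then \<psi> x else 0) - (if x = bwd True v then \<psi> x else 0))"
        by (intro sum.cong refl) (simp add: of_bool_def left_diff_distrib)
      also have "\<dots> = \<psi> v - (if bwd True v \<in> full J then \<psi> (bwd True v) else 0)"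
        using v finite_sets(1) by (simp add: sum_subtractf)
      finally have eq: "\<psi> v = (if bwd True v \<in> full J then \<psi> (bwd True v) else 0)" by simp
      show "\<psi> v = 0"
      proof (cases "bwd True v \<in> full J")
        case True
        have "snd (bwd True v) = snd v - 1" by (cases v) simp
        with True have "nat (snd (bwd True v) - m) < n"
          using m[of "bwd True v"] v by auto
        then have "\<psi> (bwd True v) = 0" using less.IH True by blast
        then show ?thesis using eq True by simp
      qed (use eq in simp)
    qed
  qed
  then show ?thesis by blast
qed

lemma dual_laplacian_pos:
  assumes c: "\<And>e. e \<in> bonds J \<Longrightarrow> 0 < c e"
  shows "0 < det_on (full J) (dual_laplacian c)"
proof (rule pos_def_on_det_pos)
  have "dual_laplacian c = (\<lambda>x x'. \<Sum>e\<in>bonds J. (1 / c e) * curl e x * curl e x')"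
    by (auto simp: dual_laplacian_def fun_eq_iff)
  moreover have "pos_def_on (full J) (\<lambda>x x'. \<Sum>e\<in>bonds J. (1 / c e) * curl e x * curl e x')"
    by (rule pos_def_on_gram) (use c finite_sets curl_injective in auto)
  ultimately show "pos_def_on (full J) (dual_laplacian c)" by simp
qed (auto simp: finite_sets dual_laplacian_def mult.commute)

context
  fixes e0 assumes e0: "e0 \<in> bonds_meeting J - bonds J"
begin

lemma gram_pos_def:
  assumes "finite F" "insert e0 (bonds J) \<subseteq> F" "\<And>e. e \<in> F \<Longrightarrow> 0 < c e"
  shows "pos_def_on J (\<lambda>u w. \<Sum>e\<in>F. c e * grad e u * grad e w)"
proof (rule pos_def_on_gram)
  fix \<phi> assume "\<And>e. e \<in> F \<Longrightarrow> (\<Sum>u\<in>J. grad e u * \<phi> u) = 0"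
  moreover have "cotree e0 \<subseteq> F" using assms(2) cotree_bottoms[OF e0] by auto
  ultimately show "\<forall>u\<in>J. \<phi> u = 0" by (intro grad_injective[OF e0]) auto
qed (use assms in auto)

text \<open>\<open>insert e0 (bonds J)\<close> splits into \<open>cotree e0\<close> and
  \<open>bottoms\<close>, of the sizes of \<open>J\<close> and \<open>full J\<close>, so
  \<open>det_gram_duality\<close> applies; the factor dropped is the square of a nonzero integer.
  The bond \<open>e0\<close> leaves no trace on the left because its conductance is 1 and it is no
  side of a full plaquette.\<close>

lemma gram_det_ge:
  assumes c: "\<And>e. e \<in> bonds J \<Longrightarrow> 0 < c e" and c0: "c e0 = 1"
  shows "(\<Prod>e\<in>bonds J. c e) * det_on (full J) (dual_laplacian c)
    \<le> det_on J (\<lambda>u w. \<Sum>e\<in>insert e0 (bonds J). c e * grad e u * grad e w)"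
proof -
  let ?X = "cotree e0" and ?Y = bottoms
  have fin: "finite ?X" "finite ?Y"
    using finite_cotree[OF e0] finite_subset[OF bottoms_subset finite_sets(2)] by auto
  note XY = cotree_bottoms[OF e0]
  have cpos: "0 < c e" if "e \<in> ?X \<union> ?Y" for e using that c[of e] c0 unfolding XY by (cases "e = e0") auto
  \<comment> \<open>Any bijection will do: it renames sites as bonds so that rows and columns share
    one index set, and the Gram determinant is invariant under renaming.\<close>
  obtain \<psi> where \<psi>: "bij_betw \<psi> ?X J"
    using finite_same_card_bij[OF fin(1) finite_J card_cotree[OF e0]] by blast
  define a where "a e s = grad e (\<psi> s)" for e s
  define g where "g e y = curl e (fst y)" for e and y :: "site \<times> bool"
  have bij: "bij_betw (\<lambda>x. (x, False)) (full J) ?Y"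
    by (auto simp: bij_betw_def bottoms_def inj_on_def)
  have g_sum: "(\<Sum>e\<in>?X \<union> ?Y. g e y * g e y' / c e) = dual_laplacian c (fst y) (fst y')"
    if "y \<in> ?Y" for y y'
  proof -
    have "fst y \<in> full J" using that by (auto simp: bottoms_def)
    then have "curl e0 (fst y) = 0" using curl_full_bonds e0 by blast
    then show ?thesis
      using e0 finite_sets unfolding XY by (simp add: g_def dual_laplacian_def)
  qed
  have dY: "det_on ?Y (\<lambda>y y'. \<Sum>e\<in>?X \<union> ?Y. g e y * g e y' / c e) = det_on (full J) (dual_laplacian c)"
  proof -
    have "det_on ?Y (\<lambda>y y'. \<Sum>e\<in>?X \<union> ?Y. g e y * g e y' / c e)
        = det_on ?Y (\<lambda>y y'. dual_laplacian c (fst y) (fst y'))"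
      by (rule det_on_cong) (rule g_sum)
    then show ?thesis by (simp add: det_on_reindex[OF bij finite_sets(1)])
  qed
  have dpos: "0 < det_on (full J) (dual_laplacian c)" using c by (rule dual_laplacian_pos)
  have main: "det_on ?X (\<lambda>s s'. \<Sum>e\<in>?X \<union> ?Y. c e * a e s * a e s')
      = (det_on ?X a)\<^sup>2 * (\<Prod>e\<in>?X \<union> ?Y. c e) * det_on (full J) (dual_laplacian c)"
    unfolding dY[symmetric]
  proof (rule det_gram_duality[OF fin XY(2)])
    show "c e \<noteq> 0" if "e \<in> ?X \<union> ?Y" for e using cpos[OF that] by simp
    show "(\<Sum>e\<in>?X \<union> ?Y. a e s * g e y) = 0" if s: "s \<in> ?X" and y: "y \<in> ?Y" for s y
    proof -
      have x: "fst y \<in> full J" using y by (auto simp: bottoms_def)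
      have "(\<Sum>e\<in>?X \<union> ?Y. curl e (fst y) * grad e (\<psi> s)) = 0"
      proof (subst curl_grad_sum)
        show "finite (?X \<union> ?Y)" using fin by simp
        show "e \<in> ?X \<union> ?Y" if "curl e (fst y) \<noteq> 0" for e
          using curl_full_bonds[OF x that] unfolding XY by blast
      qed (simp add: fwd_commute[of True False])
      then show ?thesis by (simp add: a_def g_def mult.commute)
    qed
    show "det_on ?Y (\<lambda>y e. g e y) = 1"
    \<comment> \<open>A bottom bond borders its own plaquette, with sign +1, and the one below it,
      so the height makes this matrix triangular.\<close>
    proof (rule det_on_unit_triangular[where ht = "\<lambda>y. snd (fst y)"])
      fix i j assume "i \<in> ?Y" "j \<in> ?Y" "i \<noteq> j" "g j i \<noteq> 0"
      then show "snd (fst i) < snd (fst j)"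
        by (cases i; cases j) (auto simp: g_def bottoms_def split: if_splits)
    qed (use fin in \<open>auto simp: g_def bottoms_def\<close>)
    show "det_on ?Y (\<lambda>y y'. \<Sum>e\<in>?X \<union> ?Y. g e y * g e y' / c e) \<noteq> 0"
      using dY dpos by simp
  qed
  have "det_on ?X a \<noteq> 0"
  proof
    assume "det_on ?X a = 0"
    then obtain x where x: "\<exists>i\<in>?X. x i \<noteq> 0" "\<And>i. i \<in> ?X \<Longrightarrow> (\<Sum>j\<in>?X. a i j * x j) = 0"
      using det_on_eq_0_kernel[OF fin(1)] by blast
    define \<phi> where "\<phi> u = x (inv_into ?X \<psi> u)" for u
    have inv: "\<phi> (\<psi> s) = x s" if "s \<in> ?X" for s
      using that \<psi> by (simp add: \<phi>_def bij_betw_def)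
    have "\<forall>u\<in>J. \<phi> u = 0"
    proof (rule grad_injective[OF e0])
      fix e assume e: "e \<in> ?X"
      have "(\<Sum>u\<in>J. grad e u * \<phi> u) = (\<Sum>s\<in>?X. grad e (\<psi> s) * \<phi> (\<psi> s))"
        by (rule sum.reindex_bij_betw[OF \<psi>, symmetric])
      also have "\<dots> = (\<Sum>s\<in>?X. a e s * x s)"
        by (intro sum.cong refl) (simp add: a_def inv)
      finally show "(\<Sum>u\<in>J. grad e u * \<phi> u) = 0" using x(2)[OF e] by simp
    qed
    then show False using x(1) inv bij_betwE[OF \<psi>] by metis
  qed
  moreover have "det_on ?X a \<in> \<int>"
    by (rule det_on_int) (auto simp: a_def grad_Ints)
  ultimately have "1 \<le> (det_on ?X a)\<^sup>2"
    by (metis Ints_nonzero_abs_ge1 abs_le_square_iff abs_one one_power2)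
  moreover have "0 < (\<Prod>e\<in>?X \<union> ?Y. c e)" using cpos by (rule prod_pos)
  ultimately have "(\<Prod>e\<in>?X \<union> ?Y. c e) * det_on (full J) (dual_laplacian c)
      \<le> det_on ?X (\<lambda>s s'. \<Sum>e\<in>?X \<union> ?Y. c e * a e s * a e s')"
    unfolding main using dpos by (simp add: mult.assoc)
  also have "\<dots> = det_on J (\<lambda>u w. \<Sum>e\<in>?X \<union> ?Y. c e * grad e u * grad e w)"
    by (simp add: det_on_reindex[OF \<psi> fin(1)] a_def)
  finally show ?thesis
    using e0 finite_sets c0 unfolding XY by simp
qed

lemma dirichlet_pos_def:
  assumes "\<And>e. e \<in> bonds_meeting J \<Longrightarrow> 0 < c e"
  shows "pos_def_on J (dirichlet c)"
  unfolding dirichlet_def[abs_def]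
  by (rule gram_pos_def) (use assms e0 bonds_subset finite_sets in auto)

lemma dirichlet_sym: "dirichlet c u w = dirichlet c w u"
  by (simp add: dirichlet_def mult_ac)

lemma dirichlet_det_pos:
  assumes "\<And>e. e \<in> bonds_meeting J \<Longrightarrow> 0 < c e"
  shows "0 < det_on J (dirichlet c)"
  by (rule pos_def_on_det_pos[OF finite_J dirichlet_pos_def[OF assms] dirichlet_sym])

text \<open>The boundary bonds other than \<open>e0\<close> add nonnegative diagonal terms; removing
  them lowers the determinant and leaves the case of a single ground.\<close>

lemma dirichlet_det_ge:
  assumes c: "\<And>e. e \<in> bonds_meeting J \<Longrightarrow> 0 < c e" and c0: "c e0 = 1"
  shows "(\<Prod>e\<in>bonds J. c e) * det_on (full J) (dual_laplacian c) \<le> det_on J (dirichlet c)"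
proof -
  let ?F = "insert e0 (bonds J)"
  let ?M = "\<lambda>u w. \<Sum>e\<in>?F. c e * grad e u * grad e w"
  define d where "d u = (\<Sum>e\<in>bonds_meeting J - ?F. c e * grad e u * grad e u)" for u
  have F: "?F \<subseteq> bonds_meeting J" using bonds_subset e0 by auto
  have "(\<Prod>e\<in>bonds J. c e) * det_on (full J) (dual_laplacian c) \<le> det_on J ?M"
    by (rule gram_det_ge) (use c c0 F in auto)
  also have "\<dots> \<le> det_on J (\<lambda>u w. ?M u w + (if u = w then d u else 0))"
  proof (rule det_on_add_diag_mono[OF finite_J])
    show "pos_def_on J ?M" by (rule gram_pos_def) (use finite_sets c F in auto)
    show "0 \<le> d u" for u
      unfolding d_def using c by (intro sum_nonneg) (auto simp: mult.assoc less_imp_le)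
  qed (simp add: mult_ac)
  also have "\<dots> = det_on J (dirichlet c)"
  proof (rule det_on_cong)
    fix u w assume uw: "u \<in> J" "w \<in> J"
    have "dirichlet c u w = (\<Sum>e\<in>bonds_meeting J - ?F. c e * grad e u * grad e w) + ?M u w"
      unfolding dirichlet_def by (rule sum.subset_diff[OF F finite_sets(3)])
    moreover have "(\<Sum>e\<in>bonds_meeting J - ?F. c e * grad e u * grad e w) = (if u = w then d u else 0)"
    proof (cases "u = w")
      case False
      then show ?thesis
        using grad_outside[OF uw False] by (intro trans[OF sum.neutral]) (auto simp: mult.assoc)
    qed (simp add: d_def)
    ultimately show "?M u w + (if u = w then d u else 0) = dirichlet c u w" by simp
  qed
  finally show ?thesis .
qed

end

text \<open>On \<open>bonds J\<close> the dual conductance \<open>q / weight q A f\<close> is 1 on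
  \<open>A\<close> and \<open>q\<close> elsewhere, which is the shifted configuration. The two sums
  range over different sets of bonds, but a bond in only one of them contributes zero.\<close>

lemma dirichlet_shift:
  assumes u: "u \<in> full J" "w \<in> full J" and A: "A \<subseteq> bonds J" and q: "q > 0"
  shows "dirichlet (weight q {e. shift e \<in> bonds J - A}) u w = q * dual_laplacian (weight q A) u w"
proof -
  let ?F = "\<lambda>f. (if f \<in> bonds J - A then q else 1) * (curl f u * curl f w)"
  have "dirichlet (weight q {e. shift e \<in> bonds J - A}) u w = (\<Sum>e\<in>bonds_meeting J. ?F (shift e))"
    unfolding dirichlet_def by (intro sum.cong refl) (simp add: weight_def curl_shift)
  also have "\<dots> = (\<Sum>f\<in>shift ` bonds_meeting J. ?F f)"
    by (simp add: sum.reindex[OF inj_shift])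
  also have "\<dots> = (\<Sum>f\<in>bonds J. q * (curl f u * curl f w / weight q A f))"
  proof (rule sum.mono_neutral_cong)
    show "?F f = q * (curl f u * curl f w / weight q A f)" if "f \<in> shift ` bonds_meeting J \<inter> bonds J" for f
      using that q by (auto simp: weight_def)
    show "?F f = 0" if "f \<in> shift ` bonds_meeting J - bonds J" for f
    proof -
      have "curl f u = 0" using curl_full_bonds[OF u(1)] that by blast
      then show ?thesis by simp
    qed
    show "q * (curl f u * curl f w / weight q A f) = 0" if "f \<in> bonds J - shift ` bonds_meeting J" for f
    proof -
      have "unshift f \<notin> bonds_meeting J"
        using that by (metis DiffD2 image_eqI shift_unshift(1))
      then have "grad (unshift f) u = 0"
        using grad_bonds_meeting u(1) full_subset by blast
      then show ?thesis using curl_shift[of "unshift f" u w] by simp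
    qed
  qed (use finite_sets in auto)
  also have "\<dots> = q * dual_laplacian (weight q A) u w"
    by (simp add: dual_laplacian_def sum_distrib_left)
  finally show ?thesis .
qed

text \<open>The shifted dual bond joins the lower left corners of the two plaquettes that
  \<open>(v, d)\<close> borders.\<close>

lemma shift_bonds:
  assumes "(v, d) \<in> bonds J" "v \<in> full J" "bwd (\<not> d) v \<in> full J" "shift e = (v, d)"
  shows "e \<in> bonds (full J)"
proof -
  have "e = (bwd (\<not> d) v, \<not> d)" using assms(4) by (metis shift_unshift(2) unshift.simps)
  then show ?thesis using assms(2,3) by (simp add: bonds_def)
qed

text \<open>By \<open>inner\<close>, bonds of conductance \<open>q\<close> in the image join corners
  of full plaquettes. A site of \<open>J - full J\<close> therefore has diagonal entry 4, its
  degree, and Fischer's inequality removes it at that cost; the remaining block is \<open>q\<close>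
  times the dual Laplacian, which \<open>dirichlet_det_ge\<close> controls.\<close>

theorem dirichlet_det_shift_le:
  assumes A: "A \<subseteq> bonds J" and q: "q > 0" and ne: "bonds_meeting J - bonds J \<noteq> {}"
    and inner: "\<And>v d. (v, d) \<in> bonds J - A \<Longrightarrow> v \<in> full J \<and> bwd (\<not> d) v \<in> full J"
  shows "det_on J (dirichlet (weight q {e. shift e \<in> bonds J - A})) * q ^ card A
    \<le> 4 ^ card (J - full J) * q ^ card (full J) * det_on J (dirichlet (weight q A))"
proof -
  obtain e0 where e0: "e0 \<in> bonds_meeting J - bonds J" using ne by blast
  let ?A = "{e. shift e \<in> bonds J - A}"
  let ?M = "dirichlet (weight q ?A)"
  have pos: "0 < weight q B e" for B :: "(site \<times> bool) set" and e
    using q by (simp add: weight_def)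
  have diag: "?M v v = 4" if v: "v \<in> J - full J" for v
  proof -
    have off: "weight q ?A e = 1" if "grad e v \<noteq> 0" for e
    proof -
      have "e \<notin> bonds (full J)"
        using that v by (cases e) (auto simp: bonds_def of_bool_def split: if_splits)
      then have "e \<notin> ?A"
        using inner shift_bonds by (cases "shift e") (metis DiffD1 mem_Collect_eq)
      then show ?thesis by (simp only: weight_def if_False)
    qed
    have "?M v v = (\<Sum>e\<in>bonds_meeting J. grad e v * grad e v)"
      unfolding dirichlet_def
      by (intro sum.cong refl) (metis off mult.left_neutral mult_zero_left mult_zero_right)
    also have "\<dots> = 4"
      by (rule grad_square_sum) (use finite_sets grad_bonds_meeting[of v J] v in auto)
    finally show ?thesis .
  qed
  have U: "full J \<union> (J - full J) = J" using full_subset by blast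
  have pd: "pos_def_on (full J \<union> (J - full J)) ?M"
    unfolding U by (rule dirichlet_pos_def[OF e0]) (rule pos)
  have "det_on (full J \<union> (J - full J)) ?M \<le> (\<Prod>v\<in>J - full J. ?M v v) * det_on (full J) ?M"
  proof (rule det_on_fischer[OF _ _ _ pd])
    show "?M i j = ?M j i" for i j by (rule dirichlet_sym[OF e0])
  qed (use finite_sets finite_J in auto)
  also have "(\<Prod>v\<in>J - full J. ?M v v) = 4 ^ card (J - full J)"
    by (simp only: prod.cong[OF refl diag] prod_constant)
  also have "det_on (full J) ?M = det_on (full J) (\<lambda>u w. q * dual_laplacian (weight q A) u w)"
    by (rule det_on_cong) (rule dirichlet_shift[OF _ _ A q])
  also have "\<dots> = q ^ card (full J) * det_on (full J) (dual_laplacian (weight q A))"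
    by (rule det_on_scale)
  finally have 1: "det_on J ?M \<le> 4 ^ card (J - full J) * (q ^ card (full J) * det_on (full J) (dual_laplacian (weight q A)))"
    unfolding U .
  have "(\<Prod>e\<in>bonds J. weight q A e) = q ^ card A"
  proof -
    have "(\<Prod>e\<in>bonds J. weight q A e) = (\<Prod>e\<in>A. q)"
      by (rule prod.mono_neutral_cong_right) (use A finite_sets in \<open>auto simp: weight_def\<close>)
    then show ?thesis by simp
  qed
  moreover have "(\<Prod>e\<in>bonds J. weight q A e) * det_on (full J) (dual_laplacian (weight q A))
      \<le> det_on J (dirichlet (weight q A))"
    by (rule dirichlet_det_ge[OF e0]) (use pos e0 A in \<open>auto simp: weight_def\<close>)
  ultimately have 2: "q ^ card A * det_on (full J) (dual_laplacian (weight q A)) \<le> det_on J (dirichlet (weight q A))"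
    by simp
  have "det_on J ?M * q ^ card A
      \<le> 4 ^ card (J - full J) * (q ^ card (full J) * det_on (full J) (dual_laplacian (weight q A))) * q ^ card A"
    using 1 q by (intro mult_right_mono) auto
  also have "\<dots> = 4 ^ card (J - full J) * q ^ card (full J) * (q ^ card A * det_on (full J) (dual_laplacian (weight q A)))"
    by simp
  also have "\<dots> \<le> 4 ^ card (J - full J) * q ^ card (full J) * det_on J (dirichlet (weight q A))"
    using 2 q by (intro mult_left_mono) auto
  finally show ?thesis .
qed

end

section \<open>Grounded Laplacians\<close>

definition lap_matrix :: "'e set \<Rightarrow> ('e \<Rightarrow> 'v set) \<Rightarrow> ('e \<Rightarrow> real) \<Rightarrow> 'v \<Rightarrow> 'v \<Rightarrow> real" where
  "lap_matrix E ends c u w = laplacian E ends c (\<lambda>x. of_bool (x = w)) u"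

lemma laplacian_diff:
  "laplacian E ends c (\<lambda>x. f x - g x) u = laplacian E ends c f u - laplacian E ends c g u"
proof -
  have "(\<Sum>w\<in>ends e. f u - g u - (f w - g w)) = (\<Sum>w\<in>ends e. f u - f w) - (\<Sum>w\<in>ends e. g u - g w)" for e
    unfolding sum_subtractf[symmetric] by (intro sum.cong refl) simp
  then show ?thesis
    by (simp add: laplacian_def right_diff_distrib sum_subtractf)
qed

lemma laplacian_sum:
  "laplacian E ends c (\<lambda>x. \<Sum>w\<in>V. f w x) u = (\<Sum>w\<in>V. laplacian E ends c (f w) u)"
proof -
  have "(\<Sum>w\<in>V. laplacian E ends c (f w) u)
      = (\<Sum>e\<in>{e \<in> E. u \<in> ends e}. c e * (\<Sum>w\<in>V. \<Sum>w'\<in>ends e. f w u - f w w'))"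
    unfolding laplacian_def by (subst sum.swap) (simp add: sum_distrib_left)
  also have "\<dots> = laplacian E ends c (\<lambda>x. \<Sum>w\<in>V. f w x) u"
    unfolding laplacian_def
    by (intro sum.cong refl arg_cong2[where f = "(*)"], subst sum.swap) (simp add: sum_subtractf)
  finally show ?thesis by simp
qed

lemma lap_matrix_row_sum:
  assumes "finite V" "u \<in> V" and "\<And>e. e \<in> E \<Longrightarrow> ends e \<subseteq> V"
  shows "(\<Sum>w\<in>V. lap_matrix E ends c u w) = 0"
proof -
  have "(\<Sum>w\<in>V. lap_matrix E ends c u w) = laplacian E ends c (\<lambda>x. \<Sum>w\<in>V. of_bool (x = w)) u"
    unfolding lap_matrix_def by (rule laplacian_sum[symmetric])
  also have "\<dots> = 0"
    unfolding laplacian_def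
    by (intro sum.neutral ballI) (use assms in \<open>auto simp: of_bool_def subset_iff intro!: sum.neutral\<close>)
  finally show ?thesis .
qed

text \<open>A bond contributes the sum of \<open>f u - f w'\<close> over ordered pairs of its ends,
  which is antisymmetric; this treats loops uniformly.\<close>

lemma lap_matrix_column_sum:
  assumes "finite V" "finite E" and ends: "\<And>e. e \<in> E \<Longrightarrow> ends e \<subseteq> V"
  shows "(\<Sum>u\<in>V. lap_matrix E ends c u w) = 0"
proof -
  define f where "f x = (of_bool (x = w) :: real)" for x
  define h where "h e u = c e * (\<Sum>w'\<in>ends e. f u - f w')" for e u
  have inner: "(\<Sum>u\<in>V. if u \<in> ends e then h e u else 0) = 0" if "e \<in> E" for e
  proof -
    have eq: "{u \<in> V. u \<in> ends e} = ends e" using ends[OF that] by auto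
    have "(\<Sum>u\<in>V. if u \<in> ends e then h e u else 0) = (\<Sum>u\<in>ends e. h e u)"
      using sum.inter_filter[OF assms(1), of "h e" "\<lambda>u. u \<in> ends e"] unfolding eq by simp
    also have "\<dots> = c e * ((\<Sum>u\<in>ends e. \<Sum>w'\<in>ends e. f u) - (\<Sum>u\<in>ends e. \<Sum>w'\<in>ends e. f w'))"
      by (simp add: h_def sum_distrib_left[symmetric] sum_subtractf)
    also have "(\<Sum>u\<in>ends e. \<Sum>w'\<in>ends e. f u) = (\<Sum>u\<in>ends e. \<Sum>w'\<in>ends e. f w')"
      by (rule sum.swap)
    finally show ?thesis by simp
  qed
  have "(\<Sum>u\<in>V. lap_matrix E ends c u w) = (\<Sum>u\<in>V. \<Sum>e\<in>E. if u \<in> ends e then h e u else 0)"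
    unfolding lap_matrix_def laplacian_def f_def[symmetric] h_def[symmetric]
    by (intro sum.cong refl sum.inter_filter assms)
  also have "\<dots> = (\<Sum>e\<in>E. \<Sum>u\<in>V. if u \<in> ends e then h e u else 0)"
    by (rule sum.swap)
  also have "\<dots> = 0" by (intro sum.neutral ballI inner)
  finally show ?thesis .
qed

text \<open>Determinant of the identity plus the all-ones matrix: the factor between the zero-sum
  basis in \<open>lap_det\<close> and point masses. It does not depend on the conductances and hence
  cancels from probabilities.\<close>

definition complete_det :: "'v set \<Rightarrow> real" where
  "complete_det S = det_on S (\<lambda>u w. of_bool (u = w) + 1)"

lemma complete_det_pos:
  assumes "finite S" shows "0 < complete_det S"
  unfolding complete_det_def
proof (rule pos_def_on_det_pos[OF assms])
  show "pos_def_on S (\<lambda>u w. of_bool (u = w) + 1)"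
    unfolding pos_def_on_def
  proof (intro allI impI)
    fix x :: "'a \<Rightarrow> real" assume "\<exists>i\<in>S. x i \<noteq> 0"
    then obtain k where k: "k \<in> S" "x k \<noteq> 0" by blast
    have "(\<Sum>i\<in>S. \<Sum>j\<in>S. x i * (of_bool (i = j) + 1) * x j)
        = (\<Sum>i\<in>S. \<Sum>j\<in>S. (if i = j then x i * x i else 0) + x i * x j)"
      by (intro sum.cong refl) (auto simp: algebra_simps)
    also have "\<dots> = (\<Sum>i\<in>S. x i * x i) + (\<Sum>i\<in>S. x i)\<^sup>2"
      using assms by (simp add: sum.distrib power2_eq_square sum_product)
    also have "\<dots> > 0"
      using sum_pos2[OF assms k(1), of "\<lambda>i. x i * x i"] k(2)
      by (intro add_pos_nonneg) (auto simp: zero_less_mult_iff linorder_neq_iff)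
    finally show "0 < (\<Sum>i\<in>S. \<Sum>j\<in>S. x i * (of_bool (i = j) + 1) * x j)" .
  qed
qed (auto simp: of_bool_def)

text \<open>The left-hand side does not depend on \<open>r\<close>, hence neither does the determinant on the right.
  This removes the arbitrary base vertex from \<open>lap_det\<close>.\<close>

lemma det_on_add_ones:
  fixes L :: "'v \<Rightarrow> 'v \<Rightarrow> real"
  assumes fin: "finite V" and r: "r \<in> V" and col: "\<And>w. w \<in> V \<Longrightarrow> (\<Sum>u\<in>V. L u w) = 0"
  shows "det_on V (\<lambda>u w. L u w + 1) = card V * det_on (V - {r}) (\<lambda>u w. L u w - L u r)"
proof -
  \<comment> \<open>Left multiplication by \<open>R\<close> adds all rows to row \<open>r\<close>;
    right multiplication by \<open>C\<close> subtracts column \<open>r\<close> from the others. Row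
    \<open>r\<close> then has \<open>card V\<close> on the diagonal and zeros elsewhere.\<close>
  define R where "R u w = (if u = w then 1 else if u = r then 1 else 0 :: real)" for u w
  define C where "C u w = (if u = w then 1 else if u = r then -1 else 0 :: real)" for u w
  have R1: "det_on V R = 1"
    by (rule det_on_unit_triangular[where ht = "\<lambda>i. if i = r then 0 else 1"])
      (use fin in \<open>auto simp: R_def split: if_splits\<close>)
  have C1: "det_on V C = 1"
    by (rule det_on_unit_triangular[where ht = "\<lambda>i. if i = r then 0 else 1"])
      (use fin in \<open>auto simp: C_def split: if_splits\<close>)
  define N where "N u w = (\<Sum>v\<in>V. R u v * (\<Sum>v'\<in>V. (L v v' + 1) * C v' w))" for u w
  have det: "det_on V N = det_on V (\<lambda>u w. L u w + 1)"
    unfolding N_def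
    using det_on_mult[OF fin, of R "\<lambda>v w. \<Sum>v'\<in>V. (L v v' + 1) * C v' w"]
      det_on_mult[OF fin, of "\<lambda>u w. L u w + 1" C] R1 C1 by simp
  have inner: "(\<Sum>v'\<in>V. (L v v' + 1) * C v' w) = (if w = r then L v r + 1 else L v w - L v r)"
    if "w \<in> V" for v w
  proof (cases "w = r")
    case True
    have "(\<Sum>v'\<in>V. (L v v' + 1) * C v' w) = (\<Sum>v'\<in>V. if v' = r then L v r + 1 else 0)"
      by (intro sum.cong refl) (auto simp: C_def True)
    then show ?thesis using fin r True by simp
  next
    case False
    have "(\<Sum>v'\<in>V. (L v v' + 1) * C v' w)
        = (\<Sum>v'\<in>V. (if v' = w then L v w + 1 else 0) + (if v' = r then - (L v r + 1) else 0))"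
      by (intro sum.cong refl) (use False in \<open>auto simp: C_def\<close>)
    then show ?thesis using fin r that False by (simp add: sum.distrib)
  qed
  have row: "(\<Sum>v\<in>V. R u v * f v) = (if u = r then sum f V else f u)" if "u \<in> V" for u and f :: "'v \<Rightarrow> real"
  proof (cases "u = r")
    case True
    then show ?thesis by (auto simp: R_def intro!: sum.cong)
  next
    case False
    have "(\<Sum>v\<in>V. R u v * f v) = (\<Sum>v\<in>V. if v = u then f u else 0)"
      by (intro sum.cong refl) (use False in \<open>auto simp: R_def\<close>)
    then show ?thesis using False fin that by simp
  qed
  have Nrw: "N r w = 0" if "w \<in> V - {r}" for w
    using that r col by (auto simp: N_def row inner sum_subtractf)
  have Nrr: "N r r = card V"
    using r col by (simp add: N_def row inner sum.distrib)
  have V: "V = (V - {r}) \<union> {r}" using r by auto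
  have "det_on ((V - {r}) \<union> {r}) N = det_on (V - {r}) N * det_on {r} N"
    by (rule det_on_block_triangular) (use fin Nrw in auto)
  also have "det_on (V - {r}) N = det_on (V - {r}) (\<lambda>u w. L u w - L u r)"
    by (rule det_on_cong) (auto simp: N_def row inner)
  finally show ?thesis using det V Nrr by simp
qed

text \<open>Once the base vertex has been moved to \<open>r\<close>, vanishing row sums express
  minus the entry in column \<open>r\<close> as the sum of the others, so the matrix factors into
  the grounded Laplacian and the identity plus all ones.\<close>

lemma lap_det_grounded:
  assumes fin: "finite V" "finite E" and ends: "\<And>e. e \<in> E \<Longrightarrow> ends e \<subseteq> V" and r: "r \<in> V"
  shows "lap_det V E ends c = complete_det (V - {r}) * det_on (V - {r}) (lap_matrix E ends c)"
proof -
  let ?L = "lap_matrix E ends c"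
  define v0 where "v0 = (SOME v. v \<in> V)"
  have v0: "v0 \<in> V" unfolding v0_def using r by (rule someI)
  have "lap_det V E ends c = det_on (V - {v0}) (\<lambda>u w. ?L u w - ?L u v0)"
    unfolding lap_det_def Let_def v0_def[symmetric] lap_matrix_def laplacian_diff[symmetric]
    by (simp add: of_bool_def)
  moreover have "card V * det_on (V - {v0}) (\<lambda>u w. ?L u w - ?L u v0)
      = card V * det_on (V - {r}) (\<lambda>u w. ?L u w - ?L u r)"
  proof -
    have col: "(\<Sum>u\<in>V. ?L u w) = 0" for w by (rule lap_matrix_column_sum[OF fin ends])
    show ?thesis
      using det_on_add_ones[OF fin(1) v0 col] det_on_add_ones[OF fin(1) r col] by (rule subst)
  qed
  moreover have "card V \<noteq> 0" using fin r by auto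
  ultimately have "lap_det V E ends c = det_on (V - {r}) (\<lambda>u w. ?L u w - ?L u r)" by simp
  also have "\<dots> = det_on (V - {r}) (\<lambda>u w. \<Sum>v\<in>V - {r}. ?L u v * (of_bool (v = w) + 1))"
  proof (rule det_on_cong)
    fix u w assume uw: "u \<in> V - {r}" "w \<in> V - {r}"
    have "(\<Sum>v\<in>V - {r}. ?L u v * (of_bool (v = w) + 1))
        = (\<Sum>v\<in>V - {r}. (if v = w then ?L u w else 0) + ?L u v)"
      by (intro sum.cong refl) (auto simp: algebra_simps)
    also have "\<dots> = ?L u w + (\<Sum>v\<in>V - {r}. ?L u v)"
      using fin uw by (simp add: sum.distrib)
    also have "(\<Sum>v\<in>V - {r}. ?L u v) = - ?L u r"
    proof -
      have "(\<Sum>v\<in>V. ?L u v) = 0" by (rule lap_matrix_row_sum[OF fin(1) _ ends]) (use uw in auto)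
      then show ?thesis using sum.remove[OF fin(1) r, of "?L u"] by linarith
    qed
    finally show "?L u w - ?L u r = (\<Sum>v\<in>V - {r}. ?L u v * (of_bool (v = w) + 1))" by simp
  qed
  also have "\<dots> = det_on (V - {r}) ?L * complete_det (V - {r})"
    unfolding complete_det_def by (rule det_on_mult) (use fin in simp)
  finally show ?thesis by (simp add: mult.commute)
qed

text \<open>Double counting of bond ends in \<open>J\<close>: four at each site, two on an interior
  bond, one on a boundary bond.\<close>

lemma (in lattice_domain) handshake:
  "4 * card J = 2 * card (bonds J) + card (bonds_meeting J - bonds J)"
proof -
  have inner: "(\<Sum>u\<in>J. grad e u * grad e u) = (if e \<in> bonds J then 2 else 1)"
    if "e \<in> bonds_meeting J" for e
  proof -
    obtain v d where e: "e = (v, d)" by (cases e)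
    have "(\<Sum>u\<in>J. grad e u * grad e u) = (\<Sum>u\<in>J. of_bool (u = fwd d v) + of_bool (u = v))"
      by (intro sum.cong refl) (auto simp: e of_bool_def)
    also have "\<dots> = of_bool (fwd d v \<in> J) + of_bool (v \<in> J)"
      using finite_J by (simp add: sum.distrib of_bool_def)
    finally show ?thesis using that by (auto simp: e bonds_def bonds_meeting_def)
  qed
  have "4 * real (card J) = (\<Sum>u\<in>J. \<Sum>e\<in>bonds_meeting J. grad e u * grad e u)"
    using grad_square_sum[OF finite_sets(3)] grad_bonds_meeting by simp
  also have "\<dots> = (\<Sum>e\<in>bonds_meeting J. if e \<in> bonds J then 2 else 1)"
    by (subst sum.swap) (auto simp: inner intro!: sum.cong)
  also have "\<dots> = (\<Sum>e\<in>bonds_meeting J - bonds J. 1) + (\<Sum>e\<in>bonds J. 2)"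
    by (subst sum.subset_diff[OF bonds_subset finite_sets(3)]) simp
  also have "\<dots> = real (2 * card (bonds J) + card (bonds_meeting J - bonds J))"
    by simp
  finally show ?thesis by linarith
qed

section \<open>Bonds and plaquettes in the complex plane\<close>

definition emb :: "site \<Rightarrow> complex" where
  "emb v = Complex (of_int (fst v)) (of_int (snd v))"

fun bond :: "site \<times> bool \<Rightarrow> complex set" where
  "bond (v, d) = {emb v, emb (fwd d v)}"

definition centre :: "site \<Rightarrow> complex" where
  "centre v = emb v + (1 + \<i>) / 2"

lemma emb_eq_iff [simp]: "emb u = emb w \<longleftrightarrow> u = w"
  by (auto simp: emb_def prod_eq_iff)

lemma inj_emb: "inj_on emb S"
  by (simp add: inj_on_def)

lemma inj_centre: "inj_on centre S"
  by (simp add: inj_on_def centre_def)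

lemma Z2_eq: "Z2 = range emb"
proof
  show "Z2 \<subseteq> range emb"
  proof
    fix z assume "z \<in> Z2"
    then obtain a b where "Re z = of_int a" "Im z = of_int b" by (auto simp: Z2_def elim!: Ints_cases)
    then have "z = emb (a, b)" by (simp add: emb_def complex_eq_iff)
    then show "z \<in> range emb" by blast
  qed
qed (auto simp: Z2_def emb_def)

lemma int_squares_eq_1:
  fixes a b :: int
  assumes "a\<^sup>2 + b\<^sup>2 = 1"
  shows "a = 0 \<and> \<bar>b\<bar> = 1 \<or> b = 0 \<and> \<bar>a\<bar> = 1"
proof -
  have "a\<^sup>2 \<le> 1" "b\<^sup>2 \<le> 1" using assms zero_le_power2[of a] zero_le_power2[of b] by linarith+
  then have "\<bar>a\<bar> \<le> 1" "\<bar>b\<bar> \<le> 1" by (simp_all add: abs_square_le_1)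
  then have "a \<in> {-1, 0, 1}" "b \<in> {-1, 0, 1}" by auto
  then show ?thesis using assms by auto
qed

lemma cmod_emb_diff: "cmod (emb u - emb w) = 1 \<longleftrightarrow> (fst u - fst w)\<^sup>2 + (snd u - snd w)\<^sup>2 = 1"
proof -
  have "cmod (emb u - emb w) = 1 \<longleftrightarrow>
      (of_int (fst u) - of_int (fst w) :: real)\<^sup>2 + (of_int (snd u) - of_int (snd w))\<^sup>2 = 1"
    by (simp add: cmod_def emb_def)
  also have "\<dots> \<longleftrightarrow> real_of_int ((fst u - fst w)\<^sup>2 + (snd u - snd w)\<^sup>2) = real_of_int 1"
    by simp
  finally show ?thesis unfolding of_int_eq_iff .
qed

lemma nn_emb: "nn (emb u) (emb w) \<longleftrightarrow> (\<exists>d. w = fwd d u \<or> u = fwd d w)"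
proof
  assume "nn (emb u) (emb w)"
  then have "(fst u - fst w)\<^sup>2 + (snd u - snd w)\<^sup>2 = 1"
    by (simp add: nn_def cmod_emb_diff)
  then have "fst u = fst w \<and> \<bar>snd u - snd w\<bar> = 1 \<or> snd u = snd w \<and> \<bar>fst u - fst w\<bar> = 1"
    using int_squares_eq_1 by fastforce
  then have "w = fwd True u \<or> u = fwd True w \<or> w = fwd False u \<or> u = fwd False w"
    by (cases u; cases w) auto
  then show "\<exists>d. w = fwd d u \<or> u = fwd d w" by blast
next
  assume "\<exists>d. w = fwd d u \<or> u = fwd d w"
  then obtain d where "w = fwd d u \<or> u = fwd d w" by blast
  then show "nn (emb u) (emb w)"
    by (cases d; cases u; cases w) (auto simp: nn_def cmod_emb_diff Z2_eq)
qed

lemma nn_obtain: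
  assumes "nn a b"
  obtains u w d where "a = emb u" "b = emb w" "w = fwd d u \<or> u = fwd d w"
  using assms nn_emb by (metis imageE nn_def Z2_eq)

lemma inj_bond: "inj_on bond S"
proof (rule inj_onI)
  fix e f assume *: "bond e = bond f"
  obtain v d v' d' where ef: "e = (v, d)" "f = (v', d')" by (metis surj_pair)
  have "v = v' \<and> fwd d v = fwd d' v' \<or> v = fwd d' v' \<and> fwd d v = v'"
    using * by (simp add: ef doubleton_eq_iff)
  then show "e = f" unfolding ef by (cases v; cases v'; cases d; cases d') auto
qed

lemma dual_bond_centre:
  "dual_bond (emb v, emb (fwd d v)) =
    (if d then (centre v, centre (bwd False v)) else (centre (bwd True v), centre v))"
  by (cases d; cases v) (auto simp: dual_bond_def perp_def centre_def emb_def complex_eq_iff field_simps)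

lemma dual_bond_swap: "dual_bond (b, a) = prod.swap (dual_bond (a, b))"
  by (simp add: dual_bond_def perp_def add.commute)

text \<open>Reversing a bond reverses its dual, so the unordered pair of adjacent plaquettes is
  insensitive to orientation.\<close>

lemma dual_bond_sides:
  assumes "{a, b} = bond (v, d)" "dual_bond (a, b) = (p, r)"
  shows "{p, r} = {centre v, centre (bwd (\<not> d) v)}"
proof -
  have "a = emb v \<and> b = emb (fwd d v) \<or> b = emb v \<and> a = emb (fwd d v)"
    using assms(1) by (auto simp: doubleton_eq_iff)
  then show ?thesis
    using assms(2) dual_bond_centre[of v d] dual_bond_swap[of b a]
    by (cases d) (auto simp: insert_commute)
qed

lemma plaquette_corners_centre:
  "emb x \<in> plaquette_corners (centre x)" "emb (fwd False x) \<in> plaquette_corners (centre x)"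
  "emb (fwd True x) \<in> plaquette_corners (centre x)"
  "emb (fwd True (fwd False x)) \<in> plaquette_corners (centre x)"
proof -
  have key: "emb u \<in> plaquette_corners (centre x)"
    if "Re (emb u - centre x) \<in> {1/2, -1/2}" "Im (emb u - centre x) \<in> {1/2, -1/2}" for u
  proof -
    have sq: "r\<^sup>2 = 1/4" if "r \<in> {1/2, -1/2}" for r :: real
      using that by (elim insertE emptyE; hypsubst) (simp_all add: power2_eq_square)
    have "cmod (emb u - centre x) = sqrt (2 / 4)"
      unfolding cmod_def sq[OF that(1)] sq[OF that(2)] by simp
    also have "\<dots> = sqrt 2 / 2" by (simp only: real_sqrt_divide real_sqrt_four)
    finally show ?thesis by (simp add: plaquette_corners_def Z2_eq)
  qed
  show "emb x \<in> plaquette_corners (centre x)" "emb (fwd False x) \<in> plaquette_corners (centre x)"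
    "emb (fwd True x) \<in> plaquette_corners (centre x)"
    "emb (fwd True (fwd False x)) \<in> plaquette_corners (centre x)"
    by (rule key; cases x; simp add: centre_def emb_def)+
qed

lemma bond_plaquette_faces:
  assumes "x = v \<or> x = bwd (\<not> d) v"
  shows "bond (v, d) \<in> plaquette_faces (centre x)"
proof -
  have c: "emb v \<in> plaquette_corners (centre x)" "emb (fwd d v) \<in> plaquette_corners (centre x)"
    using assms plaquette_corners_centre[of x]
  proof -
    have "v = x \<or> v = fwd (\<not> d) x" using assms by auto
    then show "emb v \<in> plaquette_corners (centre x)" "emb (fwd d v) \<in> plaquette_corners (centre x)"
      using plaquette_corners_centre[of x] fwd_commute[of True False x] by (cases d; auto)+
  qed
  moreover have "cmod (emb v - emb (fwd d v)) = 1"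
    using nn_emb[of v "fwd d v"] by (auto simp: nn_def)
  ultimately show ?thesis unfolding plaquette_faces_def by auto
qed

text \<open>Some corner lies in \<open>J\<close> and some corner does not, so membership changes
  along one of the four sides.\<close>

lemma plaquette_boundary_bond:
  assumes "x \<in> touching J - full J"
  obtains v d where "(v, d) \<in> bonds_meeting J - bonds J" "x = v \<or> x = bwd (\<not> d) v"
proof -
  have "(x, False) \<in> bonds_meeting J - bonds J \<or> (x, True) \<in> bonds_meeting J - bonds J \<or>
      (fwd False x, True) \<in> bonds_meeting J - bonds J \<or> (fwd True x, False) \<in> bonds_meeting J - bonds J"
    using assms fwd_commute[of True False x]
    by (auto simp: touching_def full_def bonds_meeting_def bonds_def)
  then show thesis
    by (elim disjE) (erule that, simp)+
qed

text \<open>The odds p/(1-p) are the positive fourth root of \<open>q\<close>, and the odds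
  determine p.\<close>

lemma p_sd_eq:
  assumes "q > 0"
  shows "p_sd q = q powr (1/4) / (1 + q powr (1/4))"
  unfolding p_sd_def
proof (rule the_equality)
  define t where "t = q powr (1/4)"
  have t: "0 < t" using assms by (simp add: t_def)
  have t4: "t ^ 4 = q"
    using powr_realpow[OF t, of 4] powr_powr[of q "1/4" 4] assms by (simp add: t_def[symmetric])
  have c: "1 - t / (1 + t) = 1 / (1 + t)" using t by (simp add: field_simps)
  have R: "t / (1 + t) / (1 - t / (1 + t)) = t" unfolding c using t by simp
  show "0 < q powr (1/4) / (1 + q powr (1/4)) \<and> q powr (1/4) / (1 + q powr (1/4)) < 1 \<and>
      (q powr (1/4) / (1 + q powr (1/4)) / (1 - q powr (1/4) / (1 + q powr (1/4)))) ^ 4 = q"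
    unfolding t_def[symmetric] R
  proof (intro conjI)
    show "0 < t / (1 + t)" "t / (1 + t) < 1" using t by simp_all
  qed (rule t4)
  fix p :: real assume p: "0 < p \<and> p < 1 \<and> (p / (1 - p)) ^ 4 = q"
  have pt: "p / (1 - p) = t"
  proof (rule power_eq_imp_eq_base)
    show "(p / (1 - p)) ^ 4 = t ^ 4" using p by (simp only: t4)
    show "0 \<le> p / (1 - p)" using p by (intro divide_nonneg_nonneg) linarith+
  qed (use t in linarith, simp)
  have "t * (1 - p) = p" unfolding pt[symmetric] using p by simp
  then have "p * (1 + t) = t"
    using right_diff_distrib[of t 1 p] distrib_left[of p 1 t] mult.commute[of p t] by linarith
  then show "p = q powr (1/4) / (1 + q powr (1/4))"
    unfolding t_def[symmetric] using t by (intro eq_divide_imp) auto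
qed

section \<open>Contours\<close>

lemma path_constant:
  assumes "\<And>i. i < n \<Longrightarrow> f (xs ! i) = f (xs ! ((i + 1) mod n))" and "n = length xs" and "a \<in> set xs" "b \<in> set xs"
  shows "f a = f b"
proof -
  have "f (xs ! i) = f (xs ! 0)" if "i < n" for i
    using that
  proof (induction i)
    case (Suc i)
    then show ?case using assms(1)[of i] by simp
  qed simp
  then show ?thesis using assms(2-4) by (metis in_set_conv_nth)
qed

text \<open>If some \<open>y i\<close> lies in \<open>I\<close>, then the bond \<open>{z i, y i}\<close> belongs both to the contour and
  to the interior faces of the plaquette \<open>xs ! i\<close>, so for \<open>q \<noteq> 1\<close> there is no \<open>q\<close>-contour.
  The remaining case is the following.\<close>

locale proper_contour =
  fixes xs :: "complex list" and z y :: "nat \<Rightarrow> complex" and I :: "complex set"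
  assumes closed: "closed_dual_path xs z y"
    and interior: "is_interior xs z y I"
    and outer: "\<And>i. i < length xs \<Longrightarrow> y i \<notin> I"
begin

definition sites :: "site set" where
  "sites = {v. emb v \<in> I}"

lemma path:
  assumes "i < length xs"
  shows "nn (z i) (y i)" "dual_bond (z i, y i) = (xs ! i, xs ! ((i + 1) mod length xs))"
  using closed assms by (auto simp: closed_dual_path_def Let_def)

lemma length_pos: "0 < length xs"
  using closed by (simp add: closed_dual_path_def Let_def)

lemma z_in: "i < length xs \<Longrightarrow> z i \<in> I"
  using interior unfolding is_interior_def by blast

lemma I_root:
  obtains v where "v \<in> Z2" "I = {w. (adj_minus (path_edges xs z y))\<^sup>*\<^sup>* v w}"
  using interior unfolding is_interior_def by blast

lemma I_eq: "I = emb ` sites"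
proof -
  obtain v where v: "v \<in> Z2" "I = {w. (adj_minus (path_edges xs z y))\<^sup>*\<^sup>* v w}" by (rule I_root)
  have "w \<in> Z2" if "(adj_minus (path_edges xs z y))\<^sup>*\<^sup>* v w" for w
    using that by (induction rule: rtranclp_induct) (use v in \<open>auto simp: adj_minus_def nn_def\<close>)
  then have "I \<subseteq> range emb" using v(2) by (auto simp: Z2_eq)
  then show ?thesis by (auto simp: sites_def)
qed

lemma finite_sites: "finite sites"
proof -
  obtain B where B: "\<And>w. w \<in> I \<Longrightarrow> norm w \<le> B"
    using interior by (auto simp: is_interior_def bounded_iff)
  have "sites \<subseteq> {-\<lceil>B\<rceil>..\<lceil>B\<rceil>} \<times> {-\<lceil>B\<rceil>..\<lceil>B\<rceil>}"
  proof (rule subrelI)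
    fix a b assume "(a, b) \<in> sites"
    then have "norm (emb (a, b)) \<le> B" by (simp add: sites_def B)
    then have "\<bar>real_of_int a\<bar> \<le> B" "\<bar>real_of_int b\<bar> \<le> B"
      using abs_Re_le_cmod[of "emb (a, b)"] abs_Im_le_cmod[of "emb (a, b)"] by (auto simp: emb_def)
    then show "(a, b) \<in> {-\<lceil>B\<rceil>..\<lceil>B\<rceil>} \<times> {-\<lceil>B\<rceil>..\<lceil>B\<rceil>}"
      by (simp add: abs_le_iff) linarith
  qed
  then show ?thesis by (rule finite_subset) simp
qed

lemma exit_in_path_edges:
  assumes "a \<in> I" "b \<notin> I" "nn a b"
  shows "{a, b} \<in> path_edges xs z y"
proof (rule ccontr)
  assume "{a, b} \<notin> path_edges xs z y"
  then have step: "adj_minus (path_edges xs z y) a b" using assms(3) by (simp add: adj_minus_def)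
  obtain v where v: "I = {w. (adj_minus (path_edges xs z y))\<^sup>*\<^sup>* v w}" by (rule I_root)
  have "(adj_minus (path_edges xs z y))\<^sup>*\<^sup>* v a" using assms(1) unfolding v mem_Collect_eq .
  then have "(adj_minus (path_edges xs z y))\<^sup>*\<^sup>* v b" using step by (rule rtranclp.rtrancl_into_rtrancl)
  then show False using assms(2) unfolding v mem_Collect_eq by contradiction
qed

text \<open>By \<open>outer\<close> each contour bond leaves the interior; conversely, a bond
  leaving the interior but missing from the contour would enlarge the component.\<close>

lemma path_edges_eq: "path_edges xs z y = bond ` (bonds_meeting sites - bonds sites)"
proof (intro equalityI subsetI)
  fix b assume "b \<in> path_edges xs z y"
  then obtain i where i: "i < length xs" "b = {z i, y i}" by (auto simp: path_edges_def)
  obtain u w d where uw: "z i = emb u" "y i = emb w" "w = fwd d u \<or> u = fwd d w"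
    using nn_obtain[OF path(1)[OF i(1)]] by metis
  have "u \<in> sites" "w \<notin> sites" using z_in[OF i(1)] outer[OF i(1)] uw by (auto simp: sites_def)
  then show "b \<in> bond ` (bonds_meeting sites - bonds sites)"
    using uw(3) unfolding i(2) uw(1,2)
  proof (elim disjE)
    assume *: "w = fwd d u" "u \<in> sites" "w \<notin> sites"
    show "{emb u, emb w} \<in> bond ` (bonds_meeting sites - bonds sites)"
      by (rule image_eqI[of _ _ "(u, d)"]) (use * in \<open>auto simp: bonds_def bonds_meeting_def\<close>)
  next
    assume *: "u = fwd d w" "u \<in> sites" "w \<notin> sites"
    show "{emb u, emb w} \<in> bond ` (bonds_meeting sites - bonds sites)"
      by (rule image_eqI[of _ _ "(w, d)"]) (use * in \<open>auto simp: bonds_def bonds_meeting_def\<close>)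
  qed
next
  fix b assume "b \<in> bond ` (bonds_meeting sites - bonds sites)"
  then obtain v d where vd: "b = {emb v, emb (fwd d v)}" "(v, d) \<in> bonds_meeting sites - bonds sites" by auto
  have "nn (emb v) (emb (fwd d v))" "nn (emb (fwd d v)) (emb v)" using nn_emb by blast+
  moreover have "emb v \<in> I \<and> emb (fwd d v) \<notin> I \<or> emb v \<notin> I \<and> emb (fwd d v) \<in> I"
    using vd(2) by (auto simp: bonds_def bonds_meeting_def sites_def)
  ultimately have "{emb v, emb (fwd d v)} \<in> path_edges xs z y \<or> {emb (fwd d v), emb v} \<in> path_edges xs z y"
    using exit_in_path_edges by blast
  then show "b \<in> path_edges xs z y" by (simp add: vd(1) insert_commute)
qed

text \<open>The end in \<open>I\<close> fixes the orientation of a contour bond, so distinct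
  directed dual bonds belong to distinct undirected bonds.\<close>

lemma length_eq: "length xs = card (bonds_meeting sites - bonds sites)"
proof -
  have "inj_on (\<lambda>i. {z i, y i}) {..<length xs}"
  proof (rule inj_onI)
    fix i j assume ij: "i \<in> {..<length xs}" "j \<in> {..<length xs}" "{z i, y i} = {z j, y j}"
    then have "z i = z j" "y i = y j"
      using z_in[of i] z_in[of j] outer[of i] outer[of j] by (auto simp: doubleton_eq_iff)
    then have "(xs ! i, xs ! ((i + 1) mod length xs)) = (xs ! j, xs ! ((j + 1) mod length xs))"
      using path(2)[of i] path(2)[of j] ij by simp
    moreover have "inj_on (\<lambda>i. (xs ! i, xs ! ((i + 1) mod length xs))) {..<length xs}"
      using closed by (simp add: closed_dual_path_def Let_def)
    ultimately show "i = j" using ij(1,2) by (auto dest: inj_onD)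
  qed
  moreover have "path_edges xs z y = (\<lambda>i. {z i, y i}) ` {..<length xs}"
    by (auto simp: path_edges_def)
  ultimately have "card (path_edges xs z y) = length xs" by (simp add: card_image)
  then show ?thesis by (simp add: path_edges_eq card_image[OF inj_bond])
qed

lemma edges_within_eq: "edges_within I = bond ` bonds sites"
proof (intro equalityI subsetI)
  fix b assume "b \<in> edges_within I"
  then obtain a a' where a: "b = {a, a'}" "a \<in> I" "a' \<in> I" "nn a a'" by (auto simp: edges_within_def)
  obtain u w d where uw: "a = emb u" "a' = emb w" "w = fwd d u \<or> u = fwd d w"
    using nn_obtain[OF a(4)] by metis
  then have "(u, d) \<in> bonds sites \<and> b = bond (u, d) \<or> (w, d) \<in> bonds sites \<and> b = bond (w, d)"
    using a by (auto simp: bonds_def sites_def)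
  then show "b \<in> bond ` bonds sites" by blast
next
  fix b assume "b \<in> bond ` bonds sites"
  then obtain v d where vd: "b = {emb v, emb (fwd d v)}" "emb v \<in> I" "emb (fwd d v) \<in> I"
    by (auto simp: bonds_def sites_def)
  have "nn (emb v) (emb (fwd d v))" using nn_emb by blast
  then show "b \<in> edges_within I" using vd by (auto simp: edges_within_def)
qed

lemma boundary_sides:
  assumes "(v, d) \<in> bonds_meeting sites - bonds sites"
  obtains i where "i < length xs"
    "{xs ! i, xs ! ((i + 1) mod length xs)} = {centre v, centre (bwd (\<not> d) v)}"
proof -
  have "bond (v, d) \<in> path_edges xs z y" using assms path_edges_eq by blast
  then obtain i where i: "i < length xs" "{z i, y i} = bond (v, d)" by (auto simp: path_edges_def)
  show thesis by (rule that[OF i(1) dual_bond_sides[OF i(2) path(2)[OF i(1)]]])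
qed

lemma centre_on_path:
  assumes "x \<in> touching sites - full sites"
  shows "centre x \<in> set xs"
proof -
  obtain v d where vd: "(v, d) \<in> bonds_meeting sites - bonds sites" "x = v \<or> x = bwd (\<not> d) v"
    by (rule plaquette_boundary_bond[OF assms])
  obtain i where i: "i < length xs"
    "{xs ! i, xs ! ((i + 1) mod length xs)} = {centre v, centre (bwd (\<not> d) v)}"
    by (rule boundary_sides[OF vd(1)])
  have "centre x \<in> {xs ! i, xs ! ((i + 1) mod length xs)}" using vd(2) i(2) by auto
  moreover have "(i + 1) mod length xs < length xs" using length_pos by simp
  ultimately show ?thesis using i(1) by (auto simp del: One_nat_def)
qed

text \<open>Connectedness of the interior is reachability from its root. For the dual part,
  consecutive points of \<open>xs\<close> are the two sides of a boundary bond, and every incomplete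
  plaquette touching the interior has its centre on \<open>xs\<close>.\<close>

sublocale lattice_domain sites
proof
  show "finite sites" by (rule finite_sites)
next
  fix \<phi> :: "site \<Rightarrow> real" and u w
  assume eq: "\<And>v d. (v, d) \<in> bonds sites \<Longrightarrow> \<phi> (fwd d v) = \<phi> v" and uw: "u \<in> sites" "w \<in> sites"
  obtain r where r: "r \<in> Z2" "I = {w. (adj_minus (path_edges xs z y))\<^sup>*\<^sup>* r w}" by (rule I_root)
  have reach: "\<phi> (inv_into UNIV emb b) = \<phi> (inv_into UNIV emb r)" if "(adj_minus (path_edges xs z y))\<^sup>*\<^sup>* r b" for b
    using that
  proof (induction rule: rtranclp_induct)
    case (step a b)
    have "nn a b" using step(2) by (simp add: adj_minus_def)
    then obtain v w d where vw: "a = emb v" "b = emb w" "w = fwd d v \<or> v = fwd d w"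
      by (rule nn_obtain)
    have "a \<in> I" "b \<in> I"
      unfolding r(2) mem_Collect_eq by (rule step(1), rule rtranclp.rtrancl_into_rtrancl[OF step(1,2)])
    then have vs: "v \<in> sites" "w \<in> sites" using vw by (simp_all add: sites_def)
    have "\<phi> v = \<phi> w"
      using vw(3)
    proof
      assume "w = fwd d v"
      then show ?thesis using eq[of v d] vs by (simp add: bonds_def)
    next
      assume "v = fwd d w"
      then show ?thesis using eq[of w d] vs by (simp add: bonds_def)
    qed
    moreover have "inv_into UNIV emb (emb v) = v" for v by (rule inv_f_f) (rule inj_emb)
    ultimately show ?case using step(3) vw by simp
  qed simp
  have "\<phi> (inv_into UNIV emb (emb v)) = \<phi> (inv_into UNIV emb r)" if "v \<in> sites" for v
  proof (rule reach)
    have "emb v \<in> I" using that by (simp add: sites_def)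
    then show "(adj_minus (path_edges xs z y))\<^sup>*\<^sup>* r (emb v)" unfolding r(2) mem_Collect_eq .
  qed
  moreover have "inv_into UNIV emb (emb v) = v" for v by (rule inv_f_f) (rule inj_emb)
  ultimately show "\<phi> u = \<phi> w" using uw by simp
next
  fix \<psi> :: "site \<Rightarrow> real" and x x'
  assume eq: "\<And>v d. (v, d) \<in> bonds_meeting sites - bonds sites \<Longrightarrow> \<psi> v = \<psi> (bwd (\<not> d) v)"
    and x: "x \<in> touching sites - full sites" "x' \<in> touching sites - full sites"
  have inv: "inv_into UNIV centre (centre v) = v" for v by (rule inv_f_f) (rule inj_centre)
  have "\<psi> (inv_into UNIV centre (centre x)) = \<psi> (inv_into UNIV centre (centre x'))"
  proof (rule path_constant[where f = "\<lambda>c. \<psi> (inv_into UNIV centre c)", OF _ refl])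
    fix i assume i: "i < length xs"
    have "{z i, y i} \<in> bond ` (bonds_meeting sites - bonds sites)"
      unfolding path_edges_eq[symmetric] path_edges_def using i by blast
    then obtain e where e: "e \<in> bonds_meeting sites - bonds sites" "{z i, y i} = bond e" by blast
    obtain v d where vd: "(v, d) \<in> bonds_meeting sites - bonds sites" "{z i, y i} = bond (v, d)"
      using e by (cases e) blast
    have "\<psi> v = \<psi> (bwd (\<not> d) v)" by (rule eq[OF vd(1)])
    moreover have "xs ! i = centre v \<and> xs ! ((i + 1) mod length xs) = centre (bwd (\<not> d) v) \<or>
        xs ! i = centre (bwd (\<not> d) v) \<and> xs ! ((i + 1) mod length xs) = centre v"
      using dual_bond_sides[OF vd(2) path(2)[OF i]] by (simp only: doubleton_eq_iff)
    ultimately show "\<psi> (inv_into UNIV centre (xs ! i)) = \<psi> (inv_into UNIV centre (xs ! ((i + 1) mod length xs)))"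
      by (elim disjE conjE) (simp_all only: inv)
  qed (use x centre_on_path in auto)
  then show "\<psi> x = \<psi> x'" by (simp add: inv)
qed

lemma boundary_nonempty: "bonds_meeting sites - bonds sites \<noteq> {}"
  using length_pos length_eq by force

text \<open>Each such site is the lower left corner of its own incomplete plaquette, whose centre
  the path visits.\<close>

lemma card_nonfull_le: "card (sites - full sites) \<le> length xs"
proof -
  have "centre ` (sites - full sites) \<subseteq> set xs"
    using centre_on_path by (auto simp: touching_def)
  then have "card (sites - full sites) \<le> card (set xs)"
    using card_mono[of "set xs" "centre ` (sites - full sites)"] card_image[OF inj_centre] by simp
  also have "\<dots> \<le> length xs" by (rule card_length)
  finally show ?thesis .
qed

section \<open>The wired graph and its Dirichlet matrix\<close>

abbreviation (input) Eall :: "complex set set" where "Eall \<equiv> edges_within I \<union> path_edges xs z y"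

lemma Eall_eq: "Eall = bond ` bonds_meeting sites"
  using bonds_subset by (auto simp: edges_within_eq path_edges_eq)

lemma wired_vertices: "wmap I ` \<Union>Eall = insert None (Some ` I)"
proof (rule equalityI)
  show "wmap I ` \<Union>Eall \<subseteq> insert None (Some ` I)"
    by (rule image_subsetI) (simp add: wmap_def)
  have "None \<in> wmap I ` \<Union>Eall"
  proof -
    obtain e where "e \<in> bonds_meeting sites - bonds sites"
      using boundary_nonempty by blast
    then obtain v d where vd: "(v, d) \<in> bonds_meeting sites - bonds sites"
      by (cases e) blast
    then have b: "bond (v, d) \<in> Eall" unfolding Eall_eq by (intro imageI) (rule DiffD1)
    define a where "a = (if v \<in> sites then emb (fwd d v) else emb v)"
    have "a \<in> bond (v, d)" by (simp add: a_def)
    then have "a \<in> \<Union>Eall" by (rule UnionI[OF b])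
    then have "wmap I a \<in> wmap I ` \<Union>Eall" by (rule imageI)
    moreover have "wmap I a = None" using vd by (auto simp: a_def wmap_def bonds_def sites_def)
    ultimately show ?thesis by (simp only:)
  qed
  moreover have "Some a \<in> wmap I ` \<Union>Eall" if a: "a \<in> I" for a
  proof -
    obtain u where u: "a = emb u" "u \<in> sites" 
      using equalityD1[OF I_eq] a by blast
    then have "(u, False) \<in> bonds_meeting sites" by (simp add: bonds_meeting_def)
    then have b: "bond (u, False) \<in> Eall" unfolding Eall_eq by (rule imageI)
    have "a \<in> bond (u, False)" by (simp add: u)
    then have "a \<in> \<Union>Eall" by (rule UnionI[OF b])
    then have "wmap I a \<in> wmap I ` \<Union>Eall" by (rule imageI)
    moreover have "wmap I a = Some a" using a by (simp add: wmap_def)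
    ultimately show ?thesis by (simp only:)
  qed
  ultimately show "insert None (Some ` I) \<subseteq> wmap I ` \<Union>Eall" by blast
qed

text \<open>Every bond has an end in the interior, so wiring creates no loops and the two images of
  its ends are distinct.\<close>

lemma incidence:
  assumes "e \<in> bonds_meeting sites" "u \<in> sites" "w \<in> sites"
  shows "(if Some (emb u) \<in> wmap I ` bond e
      then \<Sum>x\<in>wmap I ` bond e. of_bool (Some (emb u) = Some (emb w)) - of_bool (x = Some (emb w)) else 0)
    = grad e u * grad e w"
proof -
  obtain v d where e: "e = (v, d)" by (cases e)
  let ?a = "wmap I (emb v)" and ?b = "wmap I (emb (fwd d v))"
  have ab: "?a \<noteq> ?b" using assms(1) by (auto simp: e wmap_def bonds_meeting_def sites_def)
  have a: "?a = Some (emb x) \<longleftrightarrow> x = v" "?b = Some (emb x) \<longleftrightarrow> x = fwd d v" if "x \<in> sites" for x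
    using that by (auto simp: wmap_def sites_def)
  have "wmap I ` bond e = {?a, ?b}" by (simp add: e)
  then show ?thesis
    using ab a[OF assms(2)] a[OF assms(3)] by (auto simp: e of_bool_def)
qed

lemma lap_matrix_wired:
  assumes "u \<in> sites" "w \<in> sites"
  shows "lap_matrix Eall (\<lambda>e. wmap I ` e) c (Some (emb u)) (Some (emb w)) = dirichlet (c \<circ> bond) u w"
proof -
  have fin: "finite Eall" unfolding Eall_eq using finite_sets by simp
  have "lap_matrix Eall (\<lambda>e. wmap I ` e) c (Some (emb u)) (Some (emb w))
    = (\<Sum>e\<in>Eall. if Some (emb u) \<in> wmap I ` e
        then c e * (\<Sum>x\<in>wmap I ` e. of_bool (Some (emb u) = Some (emb w)) - of_bool (x = Some (emb w))) else 0)"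
    unfolding lap_matrix_def laplacian_def by (rule sum.inter_filter[OF fin])
  also have "\<dots> = (\<Sum>e\<in>bonds_meeting sites. if Some (emb u) \<in> wmap I ` bond e
        then c (bond e) * (\<Sum>x\<in>wmap I ` bond e. of_bool (Some (emb u) = Some (emb w)) - of_bool (x = Some (emb w))) else 0)"
    unfolding Eall_eq by (simp only: sum.reindex[OF inj_bond] comp_def)
  also have "\<dots> = (\<Sum>e\<in>bonds_meeting sites. (c \<circ> bond) e * grad e u * grad e w)"
  proof (rule sum.cong[OF refl])
    fix e assume "e \<in> bonds_meeting sites"
    from incidence[OF this assms]
    show "(if Some (emb u) \<in> wmap I ` bond e
        then c (bond e) * (\<Sum>x\<in>wmap I ` bond e. of_bool (Some (emb u) = Some (emb w)) - of_bool (x = Some (emb w))) else 0)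
      = (c \<circ> bond) e * grad e u * grad e w"
      by (simp only: mult.assoc comp_def) (cases "Some (emb u) \<in> wmap I ` bond e"; simp only: if_True if_False mult_zero_right)
  qed
  finally show ?thesis by (simp add: dirichlet_def)
qed

text \<open>Grounding at the wired vertex \<open>None\<close> leaves exactly the interior sites; the
  prefactor is the same for all conductances.\<close>

lemma lap_det_wired:
  "lap_det (wmap I ` \<Union>Eall) Eall (\<lambda>e. wmap I ` e) c
    = complete_det (Some ` I) * det_on sites (dirichlet (c \<circ> bond))"
proof -
  have V: "wmap I ` \<Union>Eall - {None} = Some ` I" unfolding wired_vertices by auto
  have bij: "bij_betw (\<lambda>v. Some (emb v)) sites (Some ` I)"
  proof -
    have "bij_betw (\<lambda>v. Some (emb v)) sites (Some ` emb ` sites)"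
      by (auto simp: bij_betw_def inj_on_def)
    then show ?thesis by (simp only: I_eq[symmetric])
  qed
  have finI: "finite I" by (rule finite_subset[OF equalityD1[OF I_eq]]) (use finite_sites in simp)
  have "lap_det (wmap I ` \<Union>Eall) Eall (\<lambda>e. wmap I ` e) c
      = complete_det (wmap I ` \<Union>Eall - {None}) *
        det_on (wmap I ` \<Union>Eall - {None}) (lap_matrix Eall (\<lambda>e. wmap I ` e) c)"
  proof (rule lap_det_grounded)
    show "finite (wmap I ` \<Union>Eall)" unfolding wired_vertices using finI by simp
    show "finite Eall" unfolding Eall_eq using finite_sets by simp
    show "None \<in> wmap I ` \<Union>Eall" unfolding wired_vertices by simp
  qed auto
  also have "det_on (wmap I ` \<Union>Eall - {None}) (lap_matrix Eall (\<lambda>e. wmap I ` e) c)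
      = det_on sites (dirichlet (c \<circ> bond))"
    unfolding V det_on_reindex[OF bij finite_sites] by (rule det_on_cong) (rule lap_matrix_wired)
  finally show ?thesis unfolding V .
qed

end

text \<open>Here \<open>a\<close> counts the bonds of conductance \<open>q\<close>, \<open>m\<close>
  the interior bonds, \<open>f\<close> the full plaquettes, \<open>j\<close> the sites and
  \<open>n\<close> the contour length; \<open>D\<close> and \<open>D'\<close> are the determinants
  of a configuration and its image, \<open>\<rho>\<close> their common factor. The power -1/2 turns
  \<open>4 ^ n\<close> into \<open>2 ^ n\<close>.\<close>

lemma weight_ratio:
  fixes q D D' \<rho> p t :: real and a m f j n :: nat
  assumes q: "1 \<le> q" and pos: "0 < D" "0 < D'" "0 < \<rho>"
    and det: "D' * q ^ a \<le> 4 ^ (j - f) * q ^ f * D"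
    and nats: "j - f \<le> n" "a \<le> m" "j + f = m + 1" "4 * j = 2 * m + n"
    and t: "t = q powr (1/4)" and p: "p = t / (1 + t)"
  shows "p ^ a * (1 - p) ^ (m - a) * (\<rho> * D) powr (-1/2)
    \<le> 2 ^ n * q powr (1/2 - real n / 8) * (p ^ (m - a) * (1 - p) ^ a * (\<rho> * D') powr (-1/2))"
proof -
  have q0: "0 < q" using q by simp
  have t0: "0 < t" using q0 by (simp add: t)
  define r where "r = 1 - p"
  have r: "r = 1 / (1 + t)" unfolding r_def p using t0 by (simp add: field_simps)
  have r0: "0 < r" using t0 by (simp add: r)
  have ptr: "p = t * r" unfolding r p by simp
  have split1: "p ^ a * r ^ (m - a) = t ^ a * r ^ m"
    using nats(2) by (simp add: ptr power_mult_distrib power_add[symmetric])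
  have split2: "p ^ (m - a) * r ^ a = t ^ (m - a) * r ^ m"
    using nats(2) by (simp add: ptr power_mult_distrib power_add[symmetric])
  define x where "x = sqrt (\<rho> * D)"
  define y where "y = sqrt (\<rho> * D')"
  have xy: "0 < x" "0 < y" using pos by (simp_all add: x_def y_def)
  have px: "(\<rho> * D) powr (-1/2) = 1 / x" and py: "(\<rho> * D') powr (-1/2) = 1 / y"
    using pos by (simp_all add: x_def y_def powr_minus_divide powr_half_sqrt)
  define s where "s = q powr ((real f - real a) / 2)"
  have "D' \<le> 4 ^ n * (q powr (real f - real a) * D)"
  proof -
    have "D' * q powr a \<le> 4 ^ (j - f) * q powr f * D"
      using det q0 by (simp add: powr_realpow)
    also have "\<dots> \<le> 4 ^ n * q powr f * D"
      using nats(1) pos q0 by (intro mult_right_mono power_increasing) auto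
    finally have "D' \<le> 4 ^ n * q powr f * D / q powr a"
      using q0 by (simp add: pos_le_divide_eq)
    then show ?thesis using q0 by (simp add: powr_diff)
  qed
  then have "\<rho> * D' \<le> \<rho> * (4 ^ n * (q powr (real f - real a) * D))"
    using pos by (intro mult_left_mono) auto
  also have "\<dots> = (2 ^ n * s)\<^sup>2 * (\<rho> * D)"
  proof -
    have "s\<^sup>2 = q powr (real f - real a)"
      unfolding s_def power2_eq_square powr_add[symmetric] by simp
    moreover have "(2 ^ n)\<^sup>2 = (4 :: real) ^ n"
      by (simp add: power2_eq_square power_mult_distrib[symmetric])
    ultimately show ?thesis by (simp add: power_mult_distrib)
  qed
  finally have "y \<le> sqrt ((2 ^ n * s)\<^sup>2 * (\<rho> * D))"
    unfolding y_def by (rule real_sqrt_le_mono)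
  also have "\<dots> = 2 ^ n * s * x"
    by (simp add: real_sqrt_mult x_def s_def)
  finally have "1 / x \<le> 2 ^ n * s * (1 / y)"
    using xy by (simp add: field_simps)
  then have "t ^ a * r ^ m * (1 / x) \<le> t ^ a * r ^ m * (2 ^ n * s * (1 / y))"
    using t0 r0 by (intro mult_left_mono) auto
  also have "\<dots> = 2 ^ n * (t ^ a * s) * (r ^ m * (1 / y))" by simp
  also have "t ^ a * s = q powr (1/2 - real n / 8) * t ^ (m - a)"
  proof -
    have tp: "t ^ k = q powr (real k / 4)" for k
      using t0 q0 by (simp add: powr_realpow[symmetric] t powr_powr mult.commute)
    have "real a / 4 + (real f - real a) / 2 = (1/2 - real n / 8) + real (m - a) / 4"
    proof -
      have "real j + real f = real m + 1" "4 * real j = 2 * real m + real n"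
        using nats(3,4) by linarith+
      then show ?thesis using nats(2) by (simp add: of_nat_diff field_simps)
    qed
    then show ?thesis unfolding tp s_def powr_add[symmetric] by (rule arg_cong)
  qed
  finally show ?thesis
    unfolding r_def[symmetric] px py split1 split2 by (simp only: mult_ac)
qed

text \<open>Settles \<open>q = 1\<close>, where the claimed bound is at least 1.\<close>

lemma gibbs_prob_le_1:
  assumes "0 \<le> p" "p \<le> 1"
  shows "gibbs_prob V E ends E'' lam p q P \<le> 1"
proof (cases "finite E''")
  case True
  have nonneg: "0 \<le> cfg_weight V E ends E'' lam p q A" for A
    using assms by (simp add: cfg_weight_def)
  have "(\<Sum>A\<in>{A. A \<subseteq> E'' \<and> P (cfg E'' lam q A)}. cfg_weight V E ends E'' lam p q A)
      \<le> (\<Sum>A\<in>Pow E''. cfg_weight V E ends E'' lam p q A)"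
    using True nonneg by (intro sum_mono2) auto
  moreover have "0 \<le> (\<Sum>A\<in>Pow E''. cfg_weight V E ends E'' lam p q A)"
    by (intro sum_nonneg nonneg)
  ultimately show ?thesis
    unfolding gibbs_prob_def by (simp add: divide_le_eq_1) linarith
\<comment> \<open>For infinite \<open>E''\<close> the sum over \<open>Pow E''\<close> is 0 by
  convention, and so is the quotient.\<close>
qed (simp add: gibbs_prob_def)

lemma sum_ratio_le:
  fixes W :: "'a \<Rightarrow> real"
  assumes fin: "finite S" and Q: "Q \<subseteq> S" and T: "inj_on T Q" "T ` Q \<subseteq> S"
    and nonneg: "\<And>a. a \<in> S \<Longrightarrow> 0 \<le> W a" and C: "0 \<le> C" and le: "\<And>a. a \<in> Q \<Longrightarrow> W a \<le> C * W (T a)"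
  shows "sum W Q / sum W S \<le> C"
proof -
  have "sum W Q \<le> (\<Sum>a\<in>Q. C * W (T a))" by (rule sum_mono) (rule le)
  also have "\<dots> = C * sum W (T ` Q)"
    by (simp add: sum.reindex[OF T(1)] sum_distrib_left)
  also have "\<dots> \<le> C * sum W S"
    using T(2) fin nonneg C by (intro mult_left_mono sum_mono2) auto
  finally have *: "sum W Q \<le> C * sum W S" .
  have "0 \<le> sum W S" by (rule sum_nonneg) (rule nonneg)
  \<comment> \<open>If the total weight is zero, the quotient is zero by convention.\<close>
  then show ?thesis using * C by (cases "sum W S = 0") (simp_all add: divide_le_eq)
qed

lemma cfg_bond:
  assumes "A \<subseteq> bonds J"
  shows "cfg (bond ` bonds J) (\<lambda>_. 1) q (bond ` A) \<circ> bond = weight q A"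
proof
  fix e
  have "bond e \<in> bond ` S \<longleftrightarrow> e \<in> S" for S
    by (rule inj_image_mem_iff[OF inj_bond])
  then show "(cfg (bond ` bonds J) (\<lambda>_. 1) q (bond ` A) \<circ> bond) e = weight q A e"
    using assms by (auto simp: cfg_def weight_def)
qed

text \<open>An incomplete plaquette beside an interior bond has its centre on the contour, and then
  the contour condition forces conductance \<open>q\<close> on that bond.\<close>

lemma (in proper_contour) inner_sides:
  assumes q: "q \<noteq> 1" and A: "A \<subseteq> bonds sites"
    and contour: "q_contour q xs z y I (cfg (edges_within I) (\<lambda>_. 1) q (bond ` A))"
    and vd: "(v, d) \<in> bonds sites - A"
  shows "v \<in> full sites \<and> bwd (\<not> d) v \<in> full sites"
proof -
  let ?\<kappa> = "cfg (edges_within I) (\<lambda>_. 1) q (bond ` A)"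
  have \<kappa>: "?\<kappa> (bond (v, d)) = 1"
    using fun_cong[OF cfg_bond[OF A, of q], of "(v, d)"] vd
    by (simp add: edges_within_eq weight_def)
  have "x \<in> full sites" if x: "x = v \<or> x = bwd (\<not> d) v" for x
  proof (rule ccontr)
    assume "x \<notin> full sites"
    moreover have "(v, d) \<in> bonds_meeting sites" using vd bonds_subset by blast
    ultimately have "x \<in> touching sites - full sites"
      using bond_sides_touching x by blast
    then obtain i where i: "i < length xs" "xs ! i = centre x"
      using centre_on_path in_set_conv_nth by metis
    have "bond (v, d) \<in> plaquette_faces (xs ! i)"
      unfolding i(2) using x by (rule bond_plaquette_faces)
    moreover have "bond (v, d) \<in> edges_within I"
      unfolding edges_within_eq using vd by (intro imageI) blast
    ultimately have "?\<kappa> (bond (v, d)) = q"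
      using contour i(1) unfolding q_contour_def by blast
    then show False using \<kappa> q by linarith
  qed
  then show ?thesis by blast
qed

lemma (in proper_contour) gibbs_prob_q_contour_le:
  assumes q: "1 < q"
  shows "gibbs_prob (wmap I ` \<Union>(edges_within I \<union> path_edges xs z y)) (edges_within I \<union> path_edges xs z y)
      (\<lambda>e. wmap I ` e) (edges_within I) (\<lambda>_. 1) (p_sd q) q (q_contour q xs z y I)
    \<le> 2 ^ length xs * q powr (1/2 - real (length xs) / 8)"
proof -
  define t where "t = q powr (1/4)"
  define p where "p = p_sd q"
  have p: "p = t / (1 + t)" unfolding p_def t_def by (rule p_sd_eq) (use q in simp)
  have t0: "0 < t" using q by (simp add: t_def)
  have p01: "0 \<le> p" "0 \<le> 1 - p" using t0 by (simp_all add: p field_simps)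
  define \<rho> where "\<rho> = complete_det (Some ` I)"
  have "finite I" by (rule finite_subset[OF equalityD1[OF I_eq]]) (use finite_sites in simp)
  then have \<rho>: "0 < \<rho>" unfolding \<rho>_def by (intro complete_det_pos) simp
  define det where "det A = det_on sites (dirichlet (weight q A))" for A
  obtain e0 where e0: "e0 \<in> bonds_meeting sites - bonds sites" using boundary_nonempty by blast
  have det_pos: "0 < det A" for A
    unfolding det_def by (rule dirichlet_det_pos[OF e0]) (use q in \<open>simp add: weight_def\<close>)
  define W where "W A = p ^ card A * (1 - p) ^ card (bonds sites - A) * (\<rho> * det A) powr (-1/2)" for A
  have W: "cfg_weight (wmap I ` \<Union>Eall) Eall (\<lambda>e. wmap I ` e) (edges_within I) (\<lambda>_. 1) p q (bond ` A) = W A"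
    if A: "A \<subseteq> bonds sites" for A
  proof -
    have "edges_within I - bond ` A = bond ` (bonds sites - A)"
      unfolding edges_within_eq by (rule image_set_diff[OF inj_bond, symmetric])
    moreover have "cfg (edges_within I) (\<lambda>_. 1) q (bond ` A) \<circ> bond = weight q A"
      unfolding edges_within_eq by (rule cfg_bond[OF A])
    ultimately show ?thesis
      by (simp only: cfg_weight_def lap_det_wired W_def det_def \<rho>_def card_image[OF inj_bond])
  qed
  define Q where "Q = {A. A \<subseteq> bonds sites \<and> q_contour q xs z y I (cfg (edges_within I) (\<lambda>_. 1) q (bond ` A))}"
  \<comment> \<open>A bond of the image has conductance \<open>q\<close> exactly when the bond
    crossed by it, after the shift, is interior with conductance 1.\<close>
  define T where "T A = {e. shift e \<in> bonds sites - A}" for A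
  have inj: "inj_on ((`) bond) S" for S
    by (rule inj_onI) (simp add: inj_image_eq_iff[OF inj_bond])
  have Pow: "Pow (edges_within I) = (`) bond ` Pow (bonds sites)"
    unfolding edges_within_eq by (rule image_Pow_surj[symmetric]) (rule refl)
  have Q: "{A. A \<subseteq> edges_within I \<and> q_contour q xs z y I (cfg (edges_within I) (\<lambda>_. 1) q A)} = (`) bond ` Q"
  proof -
    have "{A. A \<subseteq> edges_within I \<and> q_contour q xs z y I (cfg (edges_within I) (\<lambda>_. 1) q A)}
        = {A \<in> Pow (edges_within I). q_contour q xs z y I (cfg (edges_within I) (\<lambda>_. 1) q A)}"
      by (simp only: Pow_iff)
    moreover have "{x \<in> f ` S. R x} = f ` {a \<in> S. R (f a)}"
      for f :: "(site \<times> bool) set \<Rightarrow> complex set set" and S R by blast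
    ultimately show ?thesis by (simp only: Pow Q_def Pow_iff)
  qed
  have num: "(\<Sum>A\<in>(`) bond ` S. cfg_weight (wmap I ` \<Union>Eall) Eall (\<lambda>e. wmap I ` e) (edges_within I) (\<lambda>_. 1) p q A)
      = sum W S" if "S \<subseteq> Pow (bonds sites)" for S
    unfolding sum.reindex[OF inj] comp_def by (rule sum.cong[OF refl], rule W) (use that in blast)
  have Q_sub: "Q \<subseteq> Pow (bonds sites)" by (auto simp only: Q_def)
  have "gibbs_prob (wmap I ` \<Union>Eall) Eall (\<lambda>e. wmap I ` e) (edges_within I) (\<lambda>_. 1) p q (q_contour q xs z y I)
      = sum W Q / sum W (Pow (bonds sites))"
    unfolding gibbs_prob_def Q Pow num[OF Q_sub] num[OF order_refl] ..
  also have "\<dots> \<le> 2 ^ length xs * q powr (1/2 - real (length xs) / 8)"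
  proof (rule sum_ratio_le[where T = T])
    show "finite (Pow (bonds sites))" using finite_sets by simp
    show "Q \<subseteq> Pow (bonds sites)" by (rule Q_sub)
    show "inj_on T Q"
    proof (rule inj_onI)
      fix A B assume AB: "A \<in> Q" "B \<in> Q" "T A = T B"
      have "f \<in> bonds sites - A \<longleftrightarrow> f \<in> bonds sites - B" for f
      proof -
        have "unshift f \<in> T A \<longleftrightarrow> unshift f \<in> T B" using AB(3) by simp
        then show ?thesis by (simp add: T_def)
      qed
      moreover have "A \<subseteq> bonds sites" "B \<subseteq> bonds sites" using AB(1,2) unfolding Q_def by blast+
      ultimately show "A = B" by blast
    qed
    show "0 \<le> W A" for A using p01 by (simp add: W_def)
    have TA: "T A \<subseteq> bonds sites" "card (T A) = card (bonds sites - A)"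
      "card (bonds sites - T A) = card A" "det (T A) * q ^ card A \<le> 4 ^ card (sites - full sites) * q ^ card (full sites) * det A"
      if A: "A \<in> Q" for A
    proof -
      have A': "A \<subseteq> bonds sites" using A by (simp add: Q_def)
      have sides: "v \<in> full sites \<and> bwd (\<not> d) v \<in> full sites" if "(v, d) \<in> bonds sites - A" for v d
        by (rule inner_sides[OF _ A' _ that]) (use A q in \<open>auto simp: Q_def\<close>)
      show sub: "T A \<subseteq> bonds sites"
      proof
        fix e assume e: "e \<in> T A"
        obtain v d where vd: "shift e = (v, d)" by (cases "shift e")
        then have *: "(v, d) \<in> bonds sites - A" using e by (simp add: T_def)
        have "e \<in> bonds (full sites)"
          by (rule shift_bonds[OF _ _ _ vd]) (use * sides[OF *] in auto)
        then show "e \<in> bonds sites" using full_subset by (auto simp: bonds_def)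
      qed
      have "shift ` T A = bonds sites - A"
      proof (intro equalityI subsetI)
        fix f assume "f \<in> bonds sites - A"
        then show "f \<in> shift ` T A" by (intro image_eqI[of _ _ "unshift f"]) (simp_all add: T_def)
      qed (auto simp: T_def)
      then show c: "card (T A) = card (bonds sites - A)" using card_image[OF inj_shift, of "T A"] by simp
      have "card (bonds sites - A) = card (bonds sites) - card A" "card A \<le> card (bonds sites)"
        using A' finite_sets by (simp_all add: card_Diff_subset finite_subset card_mono)
      moreover have "card (bonds sites - T A) = card (bonds sites) - card (T A)"
        using sub finite_sets by (simp add: card_Diff_subset finite_subset)
      ultimately show "card (bonds sites - T A) = card A" using c by simp
      show "det (T A) * q ^ card A \<le> 4 ^ card (sites - full sites) * q ^ card (full sites) * det A"
        unfolding det_def T_def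
        by (rule dirichlet_det_shift_le[OF A' _ boundary_nonempty sides]) (use q in auto)
    qed
    show "T ` Q \<subseteq> Pow (bonds sites)" using TA(1) by blast
    show "W A \<le> 2 ^ length xs * q powr (1/2 - real (length xs) / 8) * W (T A)" if A: "A \<in> Q" for A
    proof -
      have A': "A \<subseteq> bonds sites" using A by (simp add: Q_def)
      have cd: "card (bonds sites - A) = card (bonds sites) - card A"
        using A' finite_sets by (simp add: card_Diff_subset finite_subset)
      have cf: "card (sites - full sites) = card sites - card (full sites)"
        using finite_sets full_subset by (simp add: card_Diff_subset)
      show ?thesis
        unfolding W_def TA(2,3)[OF A] cd
      proof (rule weight_ratio[OF _ det_pos det_pos \<rho> _ _ _ euler[OF e0] _ t_def p])
        show "det (T A) * q ^ card A \<le> 4 ^ (card sites - card (full sites)) * q ^ card (full sites) * det A"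
          using TA(4)[OF A] unfolding cf .
        show "card sites - card (full sites) \<le> length xs" using card_nonfull_le cf by simp
        show "card A \<le> card (bonds sites)" using A' finite_sets by (simp add: card_mono)
        show "4 * card sites = 2 * card (bonds sites) + length xs"
          using handshake length_eq by simp
      qed (use q in simp)
    qed
  qed (use q in simp)
  finally show ?thesis unfolding p_def .
qed

lemma q_contour_inner_bond:
  assumes path: "closed_dual_path xs z y" and i: "i < length xs" and zy: "z i \<in> I" "y i \<in> I"
    and q: "q \<noteq> 1"
  shows "\<not> q_contour q xs z y I \<kappa>"
proof
  assume contour: "q_contour q xs z y I \<kappa>"
  have nn: "nn (z i) (y i)" and dual: "dual_bond (z i, y i) = (xs ! i, xs ! ((i + 1) mod length xs))"
    using path i by (auto simp: closed_dual_path_def Let_def)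
  obtain u w d where uw: "z i = emb u" "y i = emb w" "w = fwd d u \<or> u = fwd d w"
    using nn by (rule nn_obtain)
  obtain v where v: "{z i, y i} = bond (v, d)"
  proof -
    have "{z i, y i} = bond (u, d) \<or> {z i, y i} = bond (w, d)"
      using uw by (auto simp: insert_commute)
    then show thesis using that by blast
  qed
  have "xs ! i = centre v \<or> xs ! i = centre (bwd (\<not> d) v)"
    using dual_bond_sides[OF v dual] by blast
  then have "bond (v, d) \<in> plaquette_faces (xs ! i)"
    using bond_plaquette_faces by metis
  moreover have "{z i, y i} \<in> edges_within I"
    using zy nn unfolding edges_within_def by blast
  ultimately have "\<kappa> {z i, y i} = q"
    using contour i unfolding v q_contour_def by blast
  moreover have "\<kappa> {z i, y i} = 1"
    using contour i unfolding q_contour_def path_edges_def by blast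
  ultimately show False using q by simp
qed

theorem theorem6p3:
  fixes q :: real and xs :: "complex list" and z y :: "nat \<Rightarrow> complex" and I :: "complex set"
  assumes "q \<ge> 1"
    and "is_contour xs z y"
    and "is_interior xs z y I"
  shows "(let p = p_sd q; Ei = edges_within I; E = Ei \<union> path_edges xs z y
          in gibbs_prob (wmap I ` \<Union>E) E (\<lambda>e. wmap I ` e) Ei (\<lambda>_. 1) p q
               (\<lambda>\<kappa>. q_contour q xs z y I \<kappa>))
         \<le> (4 * q powr (-1/8)) ^ length xs * q powr (1/2)"
  unfolding Let_def
proof -
  let ?P = "gibbs_prob (wmap I ` \<Union>(edges_within I \<union> path_edges xs z y)) (edges_within I \<union> path_edges xs z y)
      (\<lambda>e. wmap I ` e) (edges_within I) (\<lambda>_. 1) (p_sd q) q (q_contour q xs z y I)"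
  let ?B = "(4 * q powr (-1/8)) ^ length xs * q powr (1/2)"
  have path: "closed_dual_path xs z y" using assms(2) by (simp add: is_contour_def)
  have B0: "0 \<le> ?B" by simp
  show "?P \<le> ?B"
  proof (cases "q = 1")
    case True
    \<comment> \<open>For \<open>q = 1\<close> the contour condition carries no information, but the
      bound is then \<open>4 ^ length xs\<close>.\<close>
    have "?P \<le> 1" by (rule gibbs_prob_le_1) (simp_all add: p_sd_eq True)
    also have "1 \<le> ?B" by (simp add: True)
    finally show ?thesis .
  next
    case False
    then have q: "1 < q" using assms(1) by simp
    show ?thesis
    proof (cases "\<exists>i<length xs. y i \<in> I")
      case True
      then obtain i where i: "i < length xs" "y i \<in> I" by blast
      then have "z i \<in> I" using assms(3) unfolding is_interior_def by blast
      then have "\<not> q_contour q xs z y I \<kappa>" for \<kappa>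
        using q_contour_inner_bond[OF path i(1) _ i(2) False] by blast
      then have "?P = 0" by (simp add: gibbs_prob_def)
      then show ?thesis using B0 by linarith
    next
      case False
      then interpret proper_contour xs z y I
        by unfold_locales (use path assms(3) in auto)
      have "?P \<le> 2 ^ length xs * q powr (1/2 - real (length xs) / 8)"
        by (rule gibbs_prob_q_contour_le[OF q])
      \<comment> \<open>The comparison yields the base 2; it is relaxed here to the base 4 of the
        claim.\<close>
      also have "\<dots> \<le> 4 ^ length xs * q powr (1/2 - real (length xs) / 8)"
        by (intro mult_right_mono power_mono) auto
      also have "q powr (1/2 - real (length xs) / 8) = (q powr (-1/8)) ^ length xs * q powr (1/2)"
      proof -
        have "(q powr (-1/8)) ^ length xs = q powr (- real (length xs) / 8)"
          using q by (simp add: powr_realpow[symmetric] powr_powr mult.commute)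
        then show ?thesis by (simp add: powr_add[symmetric])
      qed
      also have "4 ^ length xs * ((q powr (-1/8)) ^ length xs * q powr (1/2)) = ?B"
        by (simp add: power_mult_distrib)
      finally show ?thesis .
    qed
  qed
qed

end
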